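(* A dimension vector $(1^a,2^b;n)$ with $a\ge 0$, $b\ge 1$, $n\ge 3$ (i.e. a dimension vector of size $2$) is dense if and only if one of the following holds: (1) $a+2b\le n+1$; (2) $a+2b=n+2$ and $a\le 3$; (3) it is one of the vectors $(2^3;3)$, $(1,2^3;3)$, $(2^4;3)$, $(1,2^3;4)$, $(2^4;5)$.
   Context: Work over an algebraically closed field of arbitrary characteristic. $Gr(d;n)$ is the Grassmannian of $d$-dimensional linear subspaces of a fixed $n$-dimensional vector space. A dimension vector $(d_1,\dots,d_k;n)$ consists of integers with $1\le d_i\le n-1$; its size is $\max_i d_i$. In exponential notation $(1^a,2^b;n)$ means that $1$ is repeated $a$ times and $2$ is repeated $b$ times. The vector is dense if the diagonal action of $\mathbb{P}GL(n)$ on $\prod_{i} Gr(d_i;n)$ has a Zariski dense orbit. *)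

theory Defs
  imports
    "HOL-Library.Poly_Mapping"
    "HOL-Library.FuncSet"
    "HOL-Computational_Algebra.Polynomial"
    "HOL-Algebra.Coset"
    "HOL-Algebra.Group_Action"
    "HOL-Analysis.Abstract_Topology"
    "Jordan_Normal_Form.VS_Connect"
    "Jordan_Normal_Form.DL_Submatrix"
begin

section \<open>Products of Grassmannians\<close>

definition Gr :: "nat \<Rightarrow> nat \<Rightarrow> 'a::field vec set set" where
  "Gr d n = {W. subspace class_ring W (module_vec TYPE('a) n) \<and>
     vectorspace.dim class_ring ((module_vec TYPE('a) n)\<lparr>carrier := W\<rparr>) = d}"

definition Gr_prod :: "nat \<Rightarrow> nat list \<Rightarrow> (nat \<Rightarrow> 'a::field vec set) set" where
  "Gr_prod n ds = (\<Pi>\<^sub>E i\<in>{..<length ds}. Gr (ds ! i) n)"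


section \<open>The Zariski topology\<close>

text \<open>
  The product of Grassmannians is a closed subvariety of a product of projective spaces via the
  Pluecker embedding in each factor. Polynomials are finitely supported families of coefficients
  indexed by monomials; the variable \<open>(i, I)\<close> is the Pluecker coordinate of the \<open>i\<close>-th subspace
  belonging to the row set \<open>I\<close>.
\<close>

definition poly_eval :: "('v \<Rightarrow> 'a) \<Rightarrow> (('v \<Rightarrow>\<^sub>0 nat) \<Rightarrow>\<^sub>0 'a) \<Rightarrow> 'a::comm_semiring_1" where
  "poly_eval x F =
     (\<Sum>m\<in>Poly_Mapping.keys F. Poly_Mapping.lookup F m *
        (\<Prod>v\<in>Poly_Mapping.keys m. x v ^ Poly_Mapping.lookup m v))"

definition plucker_vars :: "nat \<Rightarrow> nat list \<Rightarrow> (nat \<times> nat set) set" where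
  "plucker_vars n ds = (SIGMA i:{..<length ds}. {I. I \<subseteq> {..<n} \<and> card I = ds ! i})"

definition multihomogeneous ::
    "nat \<Rightarrow> nat list \<Rightarrow> (((nat \<times> nat set) \<Rightarrow>\<^sub>0 nat) \<Rightarrow>\<^sub>0 'a::zero) \<Rightarrow> bool" where
  "multihomogeneous n ds F \<longleftrightarrow>
     (\<forall>m\<in>Poly_Mapping.keys F. Poly_Mapping.keys m \<subseteq> plucker_vars n ds) \<and>
     (\<exists>e. \<forall>m\<in>Poly_Mapping.keys F. \<forall>i<length ds.
        (\<Sum>v\<in>{v \<in> Poly_Mapping.keys m. fst v = i}. Poly_Mapping.lookup m v) = e i)"

text \<open>For \<open>W \<in> Gr d n\<close>, these are the matrices whose \<open>d\<close> columns form a basis of \<open>W\<close>.\<close>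

definition frames :: "nat \<Rightarrow> nat \<Rightarrow> 'a::field vec set \<Rightarrow> 'a mat set" where
  "frames d n W = {B \<in> carrier_mat n d. vec_space.col_space n B = W}"

lemma frames_nonempty:
  assumes "W \<in> Gr d n"
  shows "frames d n (W :: 'a::field vec set) \<noteq> {}"
proof -
  interpret V: vec_space "TYPE('a)" n .
  have S: "subspace class_ring W V.V" and d: "vectorspace.dim class_ring (V.vs W) = d"
    using assms unfolding Gr_def by auto
  interpret W: vectorspace class_ring "V.vs W" by (rule V.subspace_is_vs[OF S])
  have sm: "submodule class_ring W V.V" using S unfolding subspace_def by auto
  have Wc: "W \<subseteq> carrier_vec n" using sm unfolding submodule_def by (auto simp: module_vec_simps)
  have li: "finite S \<and> card S \<le> n" if "S \<subseteq> W \<and> W.lin_indpt S" for S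
    using that Wc V.li_le_dim[of S] V.span_li_not_depend(2)[OF _ sm, of S] V.dim_is_n by auto
  have emp: "{} \<subseteq> W \<and> W.lin_indpt {}" by (auto simp: W.lin_dep_def)
  obtain B where B: "finite B" "maximal B (\<lambda>S. S \<subseteq> W \<and> W.lin_indpt S)"
    using maximal_exists[of "\<lambda>S. S \<subseteq> W \<and> W.lin_indpt S", OF li emp] by auto
  have bas: "W.basis B" using B W.max_li_is_basis by auto
  have BW: "B \<subseteq> W" "W.span B = W" using bas unfolding W.basis_def by auto
  have cB: "card B = d" using W.dim_basis[OF B(1) bas] d by simp
  obtain xs where xs: "set xs = B" "length xs = d" using B(1) cB by (metis finite_distinct_list distinct_card)
  have "V.col_space (mat_of_cols n xs) = V.span B" unfolding V.col_space_def using xs BW Wc by (subst cols_mat_of_cols) auto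
  also have "\<dots> = W" using V.span_li_not_depend(1)[OF BW(1) sm] BW by simp
  finally show ?thesis unfolding frames_def using xs mat_of_cols_carrier(1)[of n xs] by auto
qed

definition plucker :: "(nat \<Rightarrow> 'a::comm_ring_1 mat) \<Rightarrow> nat \<times> nat set \<Rightarrow> 'a" where
  "plucker B = (\<lambda>(i, I). det (submatrix (B i) I UNIV))"

text \<open>
  Changing the basis of the \<open>i\<close>-th subspace multiplies all of its Pluecker coordinates by the same
  nonzero scalar, so for multihomogeneous \<open>F\<close> non-vanishing does not depend on the choice of frames.
\<close>

definition nonvanishing ::
    "nat \<Rightarrow> nat list \<Rightarrow> (((nat \<times> nat set) \<Rightarrow>\<^sub>0 nat) \<Rightarrow>\<^sub>0 'a::field) \<Rightarrow> (nat \<Rightarrow> 'a vec set) set"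
  where
  "nonvanishing n ds F = {W \<in> Gr_prod n ds.
     \<exists>B. (\<forall>i<length ds. B i \<in> frames (ds ! i) n (W i)) \<and> poly_eval (plucker B) F \<noteq> 0}"

definition zariski :: "nat \<Rightarrow> nat list \<Rightarrow> (nat \<Rightarrow> 'a::field vec set) topology" where
  "zariski n ds = topology_generated_by {nonvanishing n ds F | F. multihomogeneous n ds F}"


lemma topspace_zariski: "topspace (zariski n ds) = (Gr_prod n ds :: (nat \<Rightarrow> 'a::field vec set) set)"
proof -
  let ?F = "1 :: ((nat \<times> nat set) \<Rightarrow>\<^sub>0 nat) \<Rightarrow>\<^sub>0 'a"
  have "multihomogeneous n ds ?F" unfolding multihomogeneous_def by auto
  moreover have "nonvanishing n ds ?F = Gr_prod n ds"
  proof -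
    have "\<exists>B. \<forall>i<length ds. B i \<in> frames (ds ! i) n (W i)" if "W \<in> Gr_prod n ds" for W :: "nat \<Rightarrow> 'a vec set"
    proof -
      have "\<forall>i<length ds. \<exists>b. b \<in> frames (ds ! i) n (W i)"
        using that frames_nonempty unfolding Gr_prod_def PiE_def Pi_def by blast
      then show ?thesis by metis
    qed
    then show ?thesis unfolding nonvanishing_def poly_eval_def by auto
  qed
  moreover have "nonvanishing n ds G \<subseteq> Gr_prod n ds" for G :: "((nat \<times> nat set) \<Rightarrow>\<^sub>0 nat) \<Rightarrow>\<^sub>0 'a"
    unfolding nonvanishing_def by auto
  ultimately show ?thesis unfolding zariski_def topology_generated_by_topspace by blast
qed


section \<open>The diagonal action of the projective linear group\<close>

definition GL :: "'a::field itself \<Rightarrow> nat \<Rightarrow> 'a mat monoid" where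
  "GL ty n = units_of (ring_mat ty n ())"

definition scalar_mats :: "nat \<Rightarrow> 'a::field mat set" where
  "scalar_mats n = {c \<cdot>\<^sub>m 1\<^sub>m n | c. c \<noteq> 0}"

definition PGL :: "'a::field itself \<Rightarrow> nat \<Rightarrow> 'a mat set monoid" where
  "PGL ty n = GL ty n Mod scalar_mats n"

text \<open>
  An element of \<open>PGL\<close> is a coset of scalar multiples of one matrix \<open>A\<close>; these all map a subspace
  \<open>W\<close> to \<open>A W\<close>, so the union below is just \<open>A W\<close>.
\<close>

definition PGL_act :: "'a::field mat set \<Rightarrow> 'a vec set \<Rightarrow> 'a vec set" where
  "PGL_act g W = (\<Union>A\<in>g. (\<lambda>w. A *\<^sub>v w) ` W)"

definition diag_act ::
    "nat list \<Rightarrow> 'a::field mat set \<Rightarrow> (nat \<Rightarrow> 'a vec set) \<Rightarrow> nat \<Rightarrow> 'a vec set" where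
  "diag_act ds g W = (\<lambda>i\<in>{..<length ds}. PGL_act g (W i))"

definition dense_dim_vector :: "'a::field itself \<Rightarrow> nat \<Rightarrow> nat list \<Rightarrow> bool" where
  "dense_dim_vector ty n ds \<longleftrightarrow>
     (\<exists>W \<in> (Gr_prod n ds :: (nat \<Rightarrow> 'a vec set) set).
        Abstract_Topology.closure_of (zariski n ds) (orbit (PGL ty n) (diag_act ds) W) = Gr_prod n ds)"

end

theory Submission
  imports Defs "Jordan_Normal_Form.DL_Rank"
begin

text \<open>
  The classification follows the dimension count. The product has dimension
  \<open>a (n - 1) + 2 b (n - 2)\<close> and the group has dimension \<open>n\<^sup>2 - 1\<close>, so a dense orbit needs
  \<open>a (n - 1) + 2 b (n - 2) < n\<^sup>2\<close>. The listed vectors are exactly those that satisfy this inequality,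
  with the exception of two points and two lines in the projective plane
  (\<open>remaining_cases_have_large_dimension\<close>).

  \<^emph>\<open>Large dimension excludes a dense orbit\<close> (\<open>not_dense_if_dimension_large\<close>). In place of dimension theory
  one compares numbers of monomials: there are more multihomogeneous polynomials of high degree on
  the product than homogeneous polynomials in the entries of a matrix \<open>A\<close> to which they can restrict
  along \<open>A \<mapsto> A W\<close>, so some nonzero one vanishes on the orbit. For two points and two lines
  in the projective plane a cross-ratio is invariant
  (\<open>not_dense_two_points_two_planes_in_3space\<close>).

  \<^emph>\<open>Surjective differential implies a dense orbit\<close> (\<open>dense_if_infinitesimally_transitive\<close>). If the
  differential of the action is surjective at one tuple \<open>C\<close> of frames, then a polynomial vanishing on
  the orbit of \<open>C\<close> has vanishing lowest Taylor term at \<open>C\<close> and is therefore zero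
  (\<open>hompoly_lowest_term\<close>). This works over every infinite field, and it turns density into the
  solvability of the linear equations \<open>X C\<^sub>i + C\<^sub>i H\<^sub>i = Y\<^sub>i\<close> for one well-chosen \<open>C\<close>. When
  \<open>a + 2 b \<le> n + 2\<close>, all subspaces but the last plane are spanned by disjoint sets of basis vectors, and
  the vectors spanning the last plane encode the linear relations between the subspaces
  (\<open>dense_at_most_one_relation\<close>, \<open>dense_two_relations\<close>). The five sporadic vectors are treated by
  explicit configurations defined over the integers.
\<close>


section \<open>Homogeneous polynomial functions\<close>

text \<open>
  Homogeneous polynomial functions are described by closure rules on functions, so that
  determinants, substitutions and Taylor coefficients are handled by rule induction and no
  coefficients appear. The zero function has every degree; without this the functions of a fixed
  degree would not be closed under sums over empty sets.
\<close>

inductive hompoly :: "'v set \<Rightarrow> nat \<Rightarrow> (('v \<Rightarrow> 'a::comm_ring_1) \<Rightarrow> 'a) \<Rightarrow> bool" for V where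
  zero: "hompoly V k (\<lambda>x. 0)"
| const: "hompoly V 0 (\<lambda>x. c)"
| var: "v \<in> V \<Longrightarrow> hompoly V 1 (\<lambda>x. x v)"
| add: "hompoly V k f \<Longrightarrow> hompoly V k g \<Longrightarrow> hompoly V k (\<lambda>x. f x + g x)"
| mult: "hompoly V k f \<Longrightarrow> hompoly V l g \<Longrightarrow> hompoly V (k + l) (\<lambda>x. f x * g x)"

lemma hompoly_smult: "hompoly V k f \<Longrightarrow> hompoly V k (\<lambda>x. c * f x)"
  using hompoly.mult[OF hompoly.const, of V k f c] by simp

lemma hompoly_sum: "(\<And>s. s \<in> S \<Longrightarrow> hompoly V k (f s)) \<Longrightarrow> hompoly V k (\<lambda>x. \<Sum>s\<in>S. f s x)"
  by (induction S rule: infinite_finite_induct) (simp_all add: hompoly.zero hompoly.add)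

lemma hompoly_prod:
  "(\<And>s. s \<in> S \<Longrightarrow> hompoly V (k s) (f s)) \<Longrightarrow> hompoly V (\<Sum>s\<in>S. k s) (\<lambda>x. \<Prod>s\<in>S. f s x)"
  by (induction S rule: infinite_finite_induct) (simp_all add: hompoly.const hompoly.mult)

lemma hompoly_power: "hompoly V k f \<Longrightarrow> hompoly V (k * m) (\<lambda>x. f x ^ m)"
  by (induction m) (simp_all add: hompoly.const hompoly.mult)

lemma hompoly_det:
  assumes "\<And>x. A x \<in> carrier_mat d d"
    and "\<And>i j. i < d \<Longrightarrow> j < d \<Longrightarrow> hompoly V 1 (\<lambda>x. A x $$ (i, j))"
  shows "hompoly V d (\<lambda>x. det (A x))"
proof -
  have "hompoly V d (\<lambda>x. \<Sum>p | p permutes {0..<d}. signof p * (\<Prod>i = 0..<d. A x $$ (i, p i)))"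
  proof (rule hompoly_sum, rule hompoly_smult)
    fix p assume "p \<in> {p. p permutes {0..<d}}"
    then have "hompoly V (\<Sum>i\<in>{0..<d}. 1) (\<lambda>x. \<Prod>i = 0..<d. A x $$ (i, p i))"
      by (intro hompoly_prod assms(2)) (auto simp: permutes_in_image)
    then show "hompoly V d (\<lambda>x. \<Prod>i = 0..<d. A x $$ (i, p i))" by simp
  qed
  then show ?thesis using det_def'[OF assms(1)] by simp
qed

lemma hompoly_curve:
  assumes "hompoly V k f"
  shows "\<exists>p. \<forall>t. f (\<lambda>v. poly (q v) t) = poly p t"
  using assms
proof induction
  case (zero k) show ?case by (rule exI[of _ 0]) auto
next
  case (const c) show ?case by (rule exI[of _ "[:c:]"]) auto
next
  case (var v) show ?case by (rule exI[of _ "q v"]) auto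
next
  case (add k f g)
  then obtain p r where "\<forall>t. f (\<lambda>v. poly (q v) t) = poly p t" "\<forall>t. g (\<lambda>v. poly (q v) t) = poly r t"
    by blast
  then show ?case by (intro exI[of _ "p + r"]) simp
next
  case (mult k f l g)
  then obtain p r where "\<forall>t. f (\<lambda>v. poly (q v) t) = poly p t" "\<forall>t. g (\<lambda>v. poly (q v) t) = poly r t"
    by blast
  then show ?case by (intro exI[of _ "p * r"]) simp
qed

text \<open>
  The polynomial \<open>P y\<close> is the expansion of \<open>f (C + t y)\<close> in powers of \<open>t\<close>. Its \<open>m\<close>-th coefficient is
  homogeneous of degree \<open>m\<close> in \<open>y\<close>: this is the degree \<open>m\<close> part of the Taylor expansion of \<open>f\<close> at \<open>C\<close>.
\<close>

lemma hompoly_taylor: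
  assumes "hompoly V k f"
  shows "\<exists>P. (\<forall>m. hompoly V m (\<lambda>y. coeff (P y) m)) \<and> (\<forall>y. degree (P y) \<le> k) \<and>
     (\<forall>t y. f (\<lambda>v. C v + t * y v) = poly (P y) t)"
  using assms
proof induction
  case (zero k) show ?case
    by (rule exI[of _ "\<lambda>y. 0"]) (simp add: hompoly.zero)
next
  case (const c)
  have "hompoly V m (\<lambda>y. coeff [:c:] m)" for m
    by (cases m) (simp_all add: hompoly.const hompoly.zero)
  then show ?case by (intro exI[of _ "\<lambda>y. [:c:]"]) simp
next
  case (var v)
  have "hompoly V m (\<lambda>y. coeff [:C v, y v:] m)" for m
  proof (cases m)
    case 0 then show ?thesis by (simp add: hompoly.const)
  next
    case (Suc l) then show ?thesis using hompoly.var[OF var]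
      by (cases l) (simp_all add: hompoly.zero)
  qed
  then show ?case
    by (intro exI[of _ "\<lambda>y. [:C v, y v:]"]) (auto)
next
  case (add k f g)
  obtain P where "\<And>m. hompoly V m (\<lambda>y. coeff (P y) m)" "\<And>y. degree (P y) \<le> k"
     "\<And>t y. f (\<lambda>v. C v + t * y v) = poly (P y) t" using add.IH(1) by blast
  moreover obtain Q where
     "\<And>m. hompoly V m (\<lambda>y. coeff (Q y) m)" "\<And>y. degree (Q y) \<le> k"
     "\<And>t y. g (\<lambda>v. C v + t * y v) = poly (Q y) t" using add.IH(2) by blast
  ultimately show ?case
    by (intro exI[of _ "\<lambda>y. P y + Q y"]) (simp add: hompoly.add degree_add_le)
next
  case (mult k f l g)
  obtain P where P: "\<And>m. hompoly V m (\<lambda>y. coeff (P y) m)" "\<And>y. degree (P y) \<le> k"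
     "\<And>t y. f (\<lambda>v. C v + t * y v) = poly (P y) t" using mult.IH(1) by blast
  obtain Q where Q:
     "\<And>m. hompoly V m (\<lambda>y. coeff (Q y) m)" "\<And>y. degree (Q y) \<le> l"
     "\<And>t y. g (\<lambda>v. C v + t * y v) = poly (Q y) t" using mult.IH(2) by blast
  note * = P Q
  have "hompoly V m (\<lambda>y. coeff (P y * Q y) m)" for m
    unfolding coeff_mult
  proof (rule hompoly_sum)
    fix i assume "i \<in> {..m}"
    then show "hompoly V m (\<lambda>y. coeff (P y) i * coeff (Q y) (m - i))"
      using hompoly.mult[OF *(1)[of i] *(4)[of "m - i"]] by simp
  qed
  moreover have "degree (P y * Q y) \<le> k + l" for y
    using degree_mult_le[of "P y" "Q y"] *(2)[of y] *(5)[of y] by linarith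
  ultimately show ?case using *(3,6)
    by (intro exI[of _ "\<lambda>y. P y * Q y"]) auto
qed

lemma poly_zero_cofinite:
  fixes p :: "'a::idom poly"
  assumes "infinite (UNIV :: 'a set)" "\<And>t. t \<noteq> 0 \<Longrightarrow> poly p t = 0"
  shows "p = 0"
proof (rule ccontr)
  assume "p \<noteq> 0"
  then have "finite {t. poly p t = 0}" by (rule poly_roots_finite)
  moreover have "UNIV - {0} \<subseteq> {t. poly p t = 0}" using assms(2) by auto
  ultimately show False using assms(1) by (meson finite_Diff2 finite.emptyI finite_insert finite_subset)
qed

text \<open>
  The space of all matrices is irreducible: on the line joining a point where \<open>f\<close> does not vanish to
  one where \<open>g\<close> does not vanish, both restrict to nonzero polynomials in one variable.
\<close>

lemma hompoly_mult_nonzero: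
  fixes f g :: "('v \<Rightarrow> 'a::idom) \<Rightarrow> 'a"
  assumes "infinite (UNIV :: 'a set)"
    and "hompoly V k f" "hompoly V l g" "f x \<noteq> 0" "g y \<noteq> 0"
  shows "\<exists>z. f z * g z \<noteq> 0"
proof -
  define q where "q = (\<lambda>v. [:x v, y v - x v:])"
  obtain p1 where p1: "\<And>t. f (\<lambda>v. poly (q v) t) = poly p1 t" using hompoly_curve[OF assms(2)] by blast
  obtain p2 where p2: "\<And>t. g (\<lambda>v. poly (q v) t) = poly p2 t" using hompoly_curve[OF assms(3)] by blast
  have "p1 \<noteq> 0" using p1[of 0] assms(4) by (auto simp: q_def)
  moreover have "p2 \<noteq> 0" using p2[of 1] assms(5) by (auto simp: q_def)
  ultimately have "p1 * p2 \<noteq> 0" by simp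
  then obtain t where "poly (p1 * p2) t \<noteq> 0" using poly_zero_cofinite[OF assms(1)] by blast
  then show ?thesis using p1[of t] p2[of t] by (intro exI[of _ "\<lambda>v. poly (q v) t"]) simp
qed

text \<open>
  A polynomial function that vanishes along curves through \<open>C\<close> in every tangent direction \<open>Y\<close> is zero.
  Otherwise its Taylor expansion at \<open>C\<close> has a lowest nonzero term; along a curve with tangent \<open>Y\<close>
  the coefficient of the lowest power of \<open>t\<close> is the value of this term at \<open>Y\<close>, so the term would
  vanish at every \<open>Y\<close>. This replaces the usual argument with the
  differential of a dominant morphism, and it does not depend on the characteristic.
\<close>

lemma hompoly_lowest_term:
  fixes f :: "('v \<Rightarrow> 'a::idom) \<Rightarrow> 'a"
  assumes inf: "infinite (UNIV :: 'a set)" and f: "hompoly V k f"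
    and van: "\<And>Y. \<exists>Z. \<forall>t. f (\<lambda>v. C v + t * (Y v + t * Z v)) = 0"
  shows "f x = 0"
proof (rule ccontr)
  assume fx: "f x \<noteq> 0"
  obtain P where P: "\<And>m. hompoly V m (\<lambda>y. coeff (P y) m)" "\<And>y. degree (P y) \<le> k"
    "\<And>t y. f (\<lambda>v. C v + t * y v) = poly (P y) t" using hompoly_taylor[OF f, of C] by blast
  have "poly (P (\<lambda>v. x v - C v)) 1 \<noteq> 0" using P(3)[of 1 "\<lambda>v. x v - C v"] fx by simp
  then have "\<exists>m y. coeff (P y) m \<noteq> 0" by (metis leading_coeff_0_iff poly_0)
  then have ex: "\<exists>m. \<exists>y. coeff (P y) m \<noteq> 0" .
  define m where "m = (LEAST m. \<exists>y. coeff (P y) m \<noteq> 0)"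
  obtain Y where Y: "coeff (P Y) m \<noteq> 0" using LeastI_ex[OF ex] unfolding m_def by blast
  have low: "coeff (P y) j = 0" if "j < m" for j y using not_less_Least[OF that[unfolded m_def]] by blast
  have mk: "m \<le> k" using Y P(2)[of Y] le_degree le_trans by blast
  obtain Z where Z: "\<And>t. f (\<lambda>v. C v + t * (Y v + t * Z v)) = 0" using van[of Y] by blast
  define q where "q = (\<lambda>v. [:Y v, Z v:])"
  have "\<exists>p. \<forall>t. coeff (P (\<lambda>v. poly (q v) t)) j = poly p t" for j
    using hompoly_curve[OF P(1)[of j], of q] by blast
  then obtain p where p: "\<And>j t. coeff (P (\<lambda>v. poly (q v) t)) j = poly (p j) t" by metis
  \<comment> \<open>The restriction of \<open>f\<close> to the curve is \<open>t ^ m * poly r t\<close>, and \<open>poly r 0\<close> is the lowest term at \<open>Y\<close>.\<close>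
  define r where "r = (\<Sum>j\<in>{m..k}. p j * monom 1 (j - m))"
  have "poly r t = 0" if "t \<noteq> 0" for t
  proof -
    have "0 = poly (P (\<lambda>v. poly (q v) t)) t"
      using P(3)[of t "\<lambda>v. poly (q v) t"] Z[of t] by (simp add: q_def)
    also have "\<dots> = (\<Sum>j\<le>k. coeff (P (\<lambda>v. poly (q v) t)) j * t ^ j)"
      using P(2) by (rule poly_as_sum_of_monoms'[THEN arg_cong[where f="\<lambda>p. poly p t"], symmetric, THEN trans]) 
        (simp add: poly_sum poly_monom)
    also have "\<dots> = (\<Sum>j\<in>{m..k}. coeff (P (\<lambda>v. poly (q v) t)) j * t ^ j)"
      by (rule sum.mono_neutral_right) (use low in auto)
    also have "\<dots> = t ^ m * poly r t"
      unfolding r_def poly_sum sum_distrib_left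
      by (rule sum.cong) (auto simp: p poly_monom power_add[symmetric])
    finally show ?thesis using that by simp
  qed
  then have "r = 0" using poly_zero_cofinite[OF inf] by blast
  then have "0 = poly r 0" by simp
  also have "\<dots> = (\<Sum>j\<in>{m..k}. if j = m then poly (p m) 0 else 0)"
    unfolding r_def poly_sum by (rule sum.cong) (auto simp: poly_monom)
  also have "\<dots> = coeff (P Y) m" using mk p[of 0 m] by (simp add: q_def)
  finally show False using Y by simp
qed


section \<open>Column spaces, frames and orbits\<close>

definition injective_mat :: "'a::field mat \<Rightarrow> bool" where
  "injective_mat B \<longleftrightarrow> (\<forall>v\<in>carrier_vec (dim_col B). B *\<^sub>v v = 0\<^sub>v (dim_row B) \<longrightarrow> v = 0\<^sub>v (dim_col B))"

definition spanned :: "nat \<Rightarrow> nat list \<Rightarrow> (nat \<Rightarrow> 'a::field mat) \<Rightarrow> nat \<Rightarrow> 'a vec set" where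
  "spanned n ds B = (\<lambda>i\<in>{..<length ds}. vec_space.col_space n (B i))"

lemma mult_mat_unit_vec:
  fixes B :: "'a::field mat"
  assumes "B \<in> carrier_mat n d" "j < d"
  shows "B *\<^sub>v unit_vec d j = col B j"
  using assms by (intro eq_vecI) auto

lemma smult_mult_mat_vec:
  fixes A :: "'a::field mat"
  assumes "A \<in> carrier_mat n m" "w \<in> carrier_vec m"
  shows "(c \<cdot>\<^sub>m A) *\<^sub>v w = A *\<^sub>v (c \<cdot>\<^sub>v w)"
  using assms by (intro eq_vecI) auto

lemma col_space_image:
  fixes B :: "'a::field mat"
  assumes "B \<in> carrier_mat n d"
  shows "vec_space.col_space n B = (\<lambda>v. B *\<^sub>v v) ` carrier_vec d"
proof -
  interpret vec_space "TYPE('a)" n .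
  show ?thesis using assms col_space_eq[OF assms] by auto
qed

lemma col_space_mult_left:
  fixes B :: "'a::field mat"
  assumes "A \<in> carrier_mat n n" "B \<in> carrier_mat n d"
  shows "vec_space.col_space n (A * B) = (\<lambda>v. A *\<^sub>v v) ` vec_space.col_space n B"
proof -
  have "A * B \<in> carrier_mat n d" using assms by simp
  then show ?thesis using assms
    by (auto simp: col_space_image[of _ n d] image_image intro!: image_cong assoc_mult_mat_vec)
qed

lemma invertible_mat_obtain_inverse:
  fixes H :: "'a::field mat"
  assumes "H \<in> carrier_mat d d" "det H \<noteq> 0"
  obtains K where "K \<in> carrier_mat d d" "H * K = 1\<^sub>m d" "K * H = 1\<^sub>m d"
  using det_non_zero_imp_unit[OF assms, of "()"] unfolding Units_def ring_mat_def by auto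

lemma col_space_mult_right:
  fixes B :: "'a::field mat"
  assumes B: "B \<in> carrier_mat n d" and H: "H \<in> carrier_mat d d" "det H \<noteq> 0"
  shows "vec_space.col_space n (B * H) = vec_space.col_space n B"
proof -
  obtain K where K: "K \<in> carrier_mat d d" "H * K = 1\<^sub>m d"
    using invertible_mat_obtain_inverse[OF H] by blast
  have BH: "B * H \<in> carrier_mat n d" using B H by simp
  have "B *\<^sub>v v \<in> (\<lambda>v. (B * H) *\<^sub>v v) ` carrier_vec d" if v: "v \<in> carrier_vec d" for v
  proof (rule image_eqI)
    show Kv: "K *\<^sub>v v \<in> carrier_vec d" using K v by simp
    have "H *\<^sub>v (K *\<^sub>v v) = v" using K H v by (metis assoc_mult_mat_vec one_mult_mat_vec)
    then show "B *\<^sub>v v = (B * H) *\<^sub>v (K *\<^sub>v v)" using assoc_mult_mat_vec[OF B H(1) Kv] by simp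
  qed
  moreover have "(B * H) *\<^sub>v v \<in> (\<lambda>v. B *\<^sub>v v) ` carrier_vec d" if v: "v \<in> carrier_vec d" for v
    using assoc_mult_mat_vec[OF B H(1) v] H(1) v by auto
  ultimately show ?thesis unfolding col_space_image[OF B] col_space_image[OF BH] by blast
qed

lemma injective_mat_mult:
  fixes B :: "'a::field mat"
  assumes A: "A \<in> carrier_mat n n" "det A \<noteq> 0" and B: "B \<in> carrier_mat n d" "injective_mat B"
    and H: "H \<in> carrier_mat d d" "det H \<noteq> 0"
  shows "injective_mat (A * B * H)"
  unfolding injective_mat_def
proof (intro ballI impI)
  fix v :: "'a vec" assume "v \<in> carrier_vec (dim_col (A * B * H))"
    and 0: "A * B * H *\<^sub>v v = 0\<^sub>v (dim_row (A * B * H))"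
  then have v: "v \<in> carrier_vec d" using H by simp
  then have Hv: "H *\<^sub>v v \<in> carrier_vec d" using H by simp
  then have BHv: "B *\<^sub>v (H *\<^sub>v v) \<in> carrier_vec n" using B by simp
  have "A * B * H *\<^sub>v v = A *\<^sub>v (B *\<^sub>v (H *\<^sub>v v))"
    using assoc_mult_mat_vec[of "A * B" n d H d v] assoc_mult_mat_vec[OF A(1) B(1) Hv] A B H v by simp
  then have "A *\<^sub>v (B *\<^sub>v (H *\<^sub>v v)) = 0\<^sub>v n" using 0 A by simp
  then have "B *\<^sub>v (H *\<^sub>v v) = 0\<^sub>v n" using det_0_iff_vec_prod_zero_field[OF A(1)] A(2) BHv by blast
  then have "H *\<^sub>v v = 0\<^sub>v d" using B Hv unfolding injective_mat_def by auto
  then have "v = 0\<^sub>v d" using det_0_iff_vec_prod_zero_field[OF H(1)] H(2) v by blast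
  then show "v = 0\<^sub>v (dim_col (A * B * H))" using H by simp
qed

lemma col_space_in_Gr:
  fixes B :: "'a::field mat"
  assumes B: "B \<in> carrier_mat n d" and inj: "injective_mat B"
  shows "vec_space.col_space n B \<in> Gr d n"
proof -
  interpret V: vec_space "TYPE('a)" n .
  have inj': "v = 0\<^sub>v d" if "v \<in> carrier_vec d" "B *\<^sub>v v = 0\<^sub>v n" for v
    using inj B that unfolding injective_mat_def by auto
  have dis: "distinct (cols B)"
  proof (rule ccontr)
    assume "\<not> distinct (cols B)"
    then obtain i j where ij: "i < d" "j < d" "i \<noteq> j" "cols B ! i = cols B ! j"
      using B unfolding distinct_conv_nth by auto
    then have c: "col B i = col B j" using B by simp
    have "B *\<^sub>v (unit_vec d i - unit_vec d j) = 0\<^sub>v n"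
      using ij c B by (simp add: mult_minus_distrib_mat_vec[of B n d] mult_mat_unit_vec[of B n d])
    then have "unit_vec d i - unit_vec d j = (0\<^sub>v d :: 'a vec)" by (intro inj') auto
    then have "(unit_vec d i - unit_vec d j :: 'a vec) $ i = 0" using ij by simp
    then show False using ij by simp
  qed
  have li: "V.lin_indpt (set (cols B))"
  proof
    assume "V.lin_dep (set (cols B))"
    then obtain v where "v \<in> carrier_vec d" "v \<noteq> 0\<^sub>v d" "B *\<^sub>v v = 0\<^sub>v n"
      using V.lin_depE[OF B _ dis] by blast
    then show False using inj' by blast
  qed
  have "V.rank B = d" by (rule V.lin_indpt_full_rank[OF B dis li])
  moreover have "subspace class_ring (V.col_space B) V.V"
    unfolding V.col_space_def using B V.span_is_subspace[of "set (cols B)"] cols_dim by auto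
  ultimately show ?thesis unfolding Gr_def V.rank_def V.col_space_def by simp
qed

lemma frame_change:
  fixes B :: "'a::field mat"
  assumes B: "B \<in> carrier_mat n d" and B': "B' \<in> carrier_mat n k"
    and sub: "vec_space.col_space n B' \<subseteq> vec_space.col_space n B"
  shows "\<exists>H\<in>carrier_mat d k. B' = B * H"
proof -
  have "\<exists>v\<in>carrier_vec d. col B' j = B *\<^sub>v v" if "j < k" for j
  proof -
    have "col B' j = B' *\<^sub>v unit_vec k j" using mult_mat_unit_vec[OF B' that] by simp
    then show ?thesis using sub unfolding col_space_image[OF B] col_space_image[OF B'] by fastforce
  qed
  then obtain v where v: "\<And>j. j < k \<Longrightarrow> v j \<in> carrier_vec d" "\<And>j. j < k \<Longrightarrow> col B' j = B *\<^sub>v v j"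
    by metis
  define H where "H = mat d k (\<lambda>(r, j). v j $ r)"
  have "B' = B * H"
  proof (rule eq_matI)
    fix r j assume "r < dim_row (B * H)" "j < dim_col (B * H)"
    then have rj: "r < n" "j < k" using B by (auto simp: H_def)
    have "col H j = v j" using v(1)[OF rj(2)] rj by (intro eq_vecI) (auto simp: H_def)
    then have "(B * H) $$ (r, j) = (B *\<^sub>v v j) $ r" using B rj by (simp add: H_def)
    also have "\<dots> = B' $$ (r, j)" using v(2)[OF rj(2), symmetric] B' rj by simp
    finally show "B' $$ (r, j) = (B * H) $$ (r, j)" by simp
  qed (use B B' in \<open>auto simp: H_def\<close>)
  then show ?thesis by (intro bexI[of _ H]) (auto simp: H_def)
qed

lemma spanned_in_Gr_prod:
  assumes "\<And>i. i < length ds \<Longrightarrow> B i \<in> carrier_mat n (ds ! i)"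
    and "\<And>i. i < length ds \<Longrightarrow> injective_mat (B i)"
  shows "spanned n ds B \<in> Gr_prod n ds"
  unfolding spanned_def Gr_prod_def using col_space_in_Gr[OF assms] by auto

lemma obtain_frames:
  assumes "W \<in> Gr_prod n ds"
  obtains B where "\<And>i. i < length ds \<Longrightarrow> B i \<in> carrier_mat n (ds ! i)" "W = spanned n ds B"
proof -
  have "\<exists>b. b \<in> frames (ds ! i) n (W i)" if "i < length ds" for i
    using assms that frames_nonempty unfolding Gr_prod_def PiE_def Pi_def by blast
  then obtain B where B: "\<And>i. i < length ds \<Longrightarrow> B i \<in> frames (ds ! i) n (W i)" by metis
  have "W = spanned n ds B"
  proof (rule extensionalityI)
    show "W \<in> extensional {..<length ds}" using assms unfolding Gr_prod_def by (auto simp: PiE_def)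
    show "spanned n ds B \<in> extensional {..<length ds}" unfolding spanned_def by simp
  qed (use B in \<open>auto simp: spanned_def frames_def\<close>)
  then show ?thesis using that[of B] B unfolding frames_def by blast
qed

lemma PGL_act_coset:
  fixes A :: "'a::field mat"
  assumes A: "A \<in> carrier_mat n n" and B: "B \<in> carrier_mat n d"
  shows "PGL_act (scalar_mats n #>\<^bsub>GL TYPE('a) n\<^esub> A) (vec_space.col_space n B) = vec_space.col_space n (A * B)"
proof -
  have scal: "(c \<cdot>\<^sub>m 1\<^sub>m n) * A *\<^sub>v (B *\<^sub>v v) = A *\<^sub>v (B *\<^sub>v (c \<cdot>\<^sub>v v))" if "v \<in> carrier_vec d" for c v
  proof -
    have "(c \<cdot>\<^sub>m 1\<^sub>m n) * A = c \<cdot>\<^sub>m A" using A by (simp add: mult_smult_assoc_mat[of "1\<^sub>m n" n n])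
    moreover have "c \<cdot>\<^sub>m A *\<^sub>v (B *\<^sub>v v) = A *\<^sub>v (c \<cdot>\<^sub>v (B *\<^sub>v v))"
      using A B that by (simp add: smult_mult_mat_vec[of A n n])
    moreover have "c \<cdot>\<^sub>v (B *\<^sub>v v) = B *\<^sub>v (c \<cdot>\<^sub>v v)" using mult_mat_vec[OF B that] by simp
    ultimately show ?thesis by simp
  qed
  have 1: "(\<Union>g\<in>scalar_mats n #>\<^bsub>GL TYPE('a) n\<^esub> A. (\<lambda>w. g *\<^sub>v w) ` S) =
    (\<Union>c\<in>-{0}. (\<lambda>w. ((c \<cdot>\<^sub>m 1\<^sub>m n) * A) *\<^sub>v w) ` S)" for S
    unfolding r_coset_def scalar_mats_def GL_def units_of_def ring_mat_def by auto
  have "PGL_act (scalar_mats n #>\<^bsub>GL TYPE('a) n\<^esub> A) (vec_space.col_space n B)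
    = (\<Union>c\<in>-{0}. (\<lambda>v. A *\<^sub>v (B *\<^sub>v (c \<cdot>\<^sub>v v))) ` carrier_vec d)"
    unfolding PGL_act_def 1 unfolding col_space_image[OF B] image_image
    by (intro SUP_cong image_cong refl scal)
  also have "\<dots> = (\<lambda>v. A *\<^sub>v (B *\<^sub>v v)) ` carrier_vec d"
  proof
    show "(\<lambda>v. A *\<^sub>v (B *\<^sub>v v)) ` carrier_vec d \<subseteq> (\<Union>c\<in>-{0}. (\<lambda>v. A *\<^sub>v (B *\<^sub>v (c \<cdot>\<^sub>v v))) ` carrier_vec d)"
      by (intro subsetI UN_I[of 1]) auto
  qed auto
  also have "\<dots> = vec_space.col_space n (A * B)"
    unfolding col_space_mult_left[OF A B] col_space_image[OF B] image_image ..
  finally show ?thesis .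
qed

text \<open>
  Scalar matrices preserve every subspace, so the orbit under cosets of scalars is the orbit under
  invertible matrices.
\<close>

lemma orbit_spanned:
  fixes B :: "nat \<Rightarrow> 'a::field mat"
  assumes B: "\<And>i. i < length ds \<Longrightarrow> B i \<in> carrier_mat n (ds ! i)"
  shows "orbit (PGL TYPE('a) n) (diag_act ds) (spanned n ds B) =
    {spanned n ds (\<lambda>i. A * B i) | A. A \<in> carrier_mat n n \<and> det A \<noteq> 0}"
proof -
  have units: "carrier (GL TYPE('a) n) = {A \<in> carrier_mat n n. det A \<noteq> 0}"
    unfolding GL_def units_of_def
    using det_non_zero_imp_unit[of _ n "()"] unit_imp_det_non_zero[of _ n "()"]
    by (auto simp: Units_def ring_mat_simps)
  have act: "diag_act ds (scalar_mats n #>\<^bsub>GL TYPE('a) n\<^esub> A) (spanned n ds B) = spanned n ds (\<lambda>i. A * B i)"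
    if "A \<in> carrier_mat n n" for A
    unfolding diag_act_def spanned_def using PGL_act_coset[OF that B] by (auto simp: fun_eq_iff restrict_def)
  have "orbit (PGL TYPE('a) n) (diag_act ds) (spanned n ds B) =
     (\<lambda>A. diag_act ds (scalar_mats n #>\<^bsub>GL TYPE('a) n\<^esub> A) (spanned n ds B)) ` {A \<in> carrier_mat n n. det A \<noteq> 0}"
    unfolding orbit_def PGL_def carrier_FactGroup units by auto
  also have "\<dots> = (\<lambda>A. spanned n ds (\<lambda>i. A * B i)) ` {A \<in> carrier_mat n n. det A \<noteq> 0}"
    by (rule image_cong) (auto simp: act)
  finally show ?thesis by auto
qed


section \<open>Multihomogeneous polynomials in Pluecker coordinates\<close>

definition monomial_eval :: "('v \<Rightarrow> 'a::comm_semiring_1) \<Rightarrow> ('v \<Rightarrow>\<^sub>0 nat) \<Rightarrow> 'a" where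
  "monomial_eval x m = (\<Prod>v\<in>Poly_Mapping.keys m. x v ^ Poly_Mapping.lookup m v)"

definition degree_in :: "nat \<Rightarrow> (nat \<times> 'i \<Rightarrow>\<^sub>0 nat) \<Rightarrow> nat" where
  "degree_in i m = (\<Sum>v\<in>{v \<in> Poly_Mapping.keys m. fst v = i}. Poly_Mapping.lookup m v)"

lemma monomial_eval_superset:
  assumes "finite A" "Poly_Mapping.keys m \<subseteq> A"
  shows "monomial_eval x m = (\<Prod>v\<in>A. x v ^ Poly_Mapping.lookup m v)"
  unfolding monomial_eval_def using assms
  by (intro prod.mono_neutral_left) (auto simp: in_keys_iff)

lemma degree_in_superset:
  assumes "finite A" "Poly_Mapping.keys m \<subseteq> A"
  shows "degree_in i m = (\<Sum>v\<in>A. if fst v = i then Poly_Mapping.lookup m v else 0)"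
proof -
  have "degree_in i m = (\<Sum>v\<in>Poly_Mapping.keys m. if fst v = i then Poly_Mapping.lookup m v else 0)"
    unfolding degree_in_def by (rule sum.mono_neutral_cong_left) auto
  also have "\<dots> = (\<Sum>v\<in>A. if fst v = i then Poly_Mapping.lookup m v else 0)"
    using assms by (intro sum.mono_neutral_left) (auto simp: in_keys_iff)
  finally show ?thesis .
qed

lemma monomial_eval_add: "monomial_eval x (m + m') = monomial_eval x m * monomial_eval x m'"
proof -
  let ?A = "Poly_Mapping.keys m \<union> Poly_Mapping.keys m'"
  show ?thesis using Poly_Mapping.keys_add[of m m']
    by (simp add: monomial_eval_superset[of ?A] lookup_add power_add prod.distrib)
qed

lemma degree_in_add: "degree_in i (m + m') = degree_in i m + degree_in i m'"
proof -
  let ?A = "Poly_Mapping.keys m \<union> Poly_Mapping.keys m'"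
  show ?thesis using Poly_Mapping.keys_add[of m m']
    by (simp add: degree_in_superset[of ?A] lookup_add sum.distrib[symmetric] if_distrib cong: if_cong)
qed

lemma monomial_eval_0 [simp]: "monomial_eval x 0 = 1"
  by (simp add: monomial_eval_def)

lemma degree_in_0 [simp]: "degree_in i 0 = 0"
  by (simp add: degree_in_def)

lemma monomial_eval_single [simp]: "monomial_eval x (Poly_Mapping.single v k) = x v ^ k"
  using monomial_eval_superset[of "{v}" "Poly_Mapping.single v k" x] by simp

lemma degree_in_single [simp]: "degree_in i (Poly_Mapping.single v k) = (if fst v = i then k else 0)"
  using degree_in_superset[of "{v}" "Poly_Mapping.single v k" i] by simp

lemma monomial_eval_sum: "monomial_eval x (\<Sum>s\<in>S. m s) = (\<Prod>s\<in>S. monomial_eval x (m s))"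
  by (induction S rule: infinite_finite_induct) (simp_all add: monomial_eval_add)

lemma degree_in_sum: "degree_in i (\<Sum>s\<in>S. m s) = (\<Sum>s\<in>S. degree_in i (m s))"
  by (induction S rule: infinite_finite_induct) (simp_all add: degree_in_add)

lemma keys_sum_subset: "Poly_Mapping.keys (\<Sum>s\<in>S. m s) \<subseteq> (\<Union>s\<in>S. Poly_Mapping.keys (m s))"
proof (induction S rule: infinite_finite_induct)
  case (insert s S)
  then show ?case using Poly_Mapping.keys_add[of "m s" "sum m S"] by auto
qed simp_all

lemma poly_eval_eq: "poly_eval x F = (\<Sum>m\<in>Poly_Mapping.keys F. Poly_Mapping.lookup F m * monomial_eval x m)"
  by (simp add: poly_eval_def monomial_eval_def)

lemma poly_eval_superset:
  assumes "finite A" "Poly_Mapping.keys F \<subseteq> A"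
  shows "poly_eval x F = (\<Sum>m\<in>A. Poly_Mapping.lookup F m * monomial_eval x m)"
  unfolding poly_eval_eq using assms
  by (intro sum.mono_neutral_left) (auto simp: in_keys_iff)

lemma poly_eval_add: "poly_eval x (F + G) = poly_eval x F + poly_eval x G"
proof -
  let ?A = "Poly_Mapping.keys F \<union> Poly_Mapping.keys G"
  show ?thesis using Poly_Mapping.keys_add[of F G]
    by (simp add: poly_eval_superset[of ?A] lookup_add distrib_right sum.distrib)
qed

lemma poly_eval_single: "poly_eval x (Poly_Mapping.single m c) = c * monomial_eval x m"
  using poly_eval_superset[of "{m}" "Poly_Mapping.single m c" x] by simp

lemma poly_eval_sum_single:
  "poly_eval x (\<Sum>s\<in>S. Poly_Mapping.single (m s) (c s)) = (\<Sum>s\<in>S. c s * monomial_eval x (m s))"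
proof (induction S rule: infinite_finite_induct)
  case (insert s S)
  then show ?case by (simp add: poly_eval_add poly_eval_single)
qed (simp_all add: poly_eval_eq)

lemma multihomogeneous_iff:
  "multihomogeneous n ds F \<longleftrightarrow> (\<forall>m\<in>Poly_Mapping.keys F. Poly_Mapping.keys m \<subseteq> plucker_vars n ds) \<and>
     (\<exists>e. \<forall>m\<in>Poly_Mapping.keys F. \<forall>i<length ds. degree_in i m = e i)"
  by (simp add: multihomogeneous_def degree_in_def)

text \<open>
  Distinct indices may give the same monomial, in which case the coefficients add up; evaluation does
  not notice. All polynomials that are needed below are produced in this form.
\<close>

lemma multihomogeneous_of_monomials:
  fixes c :: "'s \<Rightarrow> 'a::comm_semiring_1"
  assumes "\<And>s. s \<in> S \<Longrightarrow> Poly_Mapping.keys (m s) \<subseteq> plucker_vars n ds"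
    and "\<And>s i. s \<in> S \<Longrightarrow> i < length ds \<Longrightarrow> degree_in i (m s) = e i"
  shows "\<exists>F. multihomogeneous n ds F \<and> (\<forall>x. poly_eval x F = (\<Sum>s\<in>S. c s * monomial_eval x (m s)))"
proof (intro exI conjI allI)
  let ?F = "\<Sum>s\<in>S. Poly_Mapping.single (m s) (c s)"
  have "Poly_Mapping.keys ?F \<subseteq> (\<Union>s\<in>S. Poly_Mapping.keys (Poly_Mapping.single (m s) (c s)))"
    by (rule keys_sum_subset)
  also have "\<dots> \<subseteq> m ` S" by (auto split: if_splits)
  finally have k: "Poly_Mapping.keys ?F \<subseteq> m ` S" .
  show "multihomogeneous n ds ?F" unfolding multihomogeneous_iff
  proof (intro conjI exI[of _ e] ballI allI impI)
    fix k assume "k \<in> Poly_Mapping.keys ?F"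
    then obtain s where s: "s \<in> S" "k = m s" using k by blast
    show "Poly_Mapping.keys k \<subseteq> plucker_vars n ds" using assms(1)[OF s(1)] s(2) by simp
    show "degree_in i k = e i" if "i < length ds" for i using assms(2)[OF s(1) that] s(2) by simp
  qed
  show "poly_eval x ?F = (\<Sum>s\<in>S. c s * monomial_eval x (m s))" for x by (rule poly_eval_sum_single)
qed

lemma plucker_varsE:
  assumes "v \<in> plucker_vars n ds"
  obtains i I where "v = (i, I)" "i < length ds" "I \<subseteq> {..<n}" "card I = ds ! i"
  using assms that[of "fst v" "snd v"] unfolding plucker_vars_def by (cases v) auto

lemma prod_by_factor:
  assumes "Poly_Mapping.keys m \<subseteq> plucker_vars n ds"
  shows "(\<Prod>v\<in>Poly_Mapping.keys m. y (fst v) ^ Poly_Mapping.lookup m v) = (\<Prod>i<length ds. y i ^ degree_in i m)"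
proof -
  have "(\<Prod>i<length ds. y i ^ degree_in i m) =
      (\<Prod>i<length ds. \<Prod>v\<in>{v \<in> Poly_Mapping.keys m. fst v = i}. y (fst v) ^ Poly_Mapping.lookup m v)"
    by (intro prod.cong refl) (simp add: degree_in_def power_sum)
  also have "\<dots> = (\<Prod>v\<in>Poly_Mapping.keys m. y (fst v) ^ Poly_Mapping.lookup m v)"
    by (rule prod.group) (use assms in \<open>auto simp: plucker_vars_def\<close>)
  finally show ?thesis by simp
qed

lemma sum_by_factor:
  assumes "Poly_Mapping.keys m \<subseteq> plucker_vars n ds"
  shows "(\<Sum>v\<in>Poly_Mapping.keys m. y (fst v) * Poly_Mapping.lookup m v) = (\<Sum>i<length ds. y i * degree_in i m)"
proof -
  have "(\<Sum>i<length ds. y i * degree_in i m) =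
      (\<Sum>i<length ds. \<Sum>v\<in>{v \<in> Poly_Mapping.keys m. fst v = i}. y (fst v) * Poly_Mapping.lookup m v)"
    by (intro sum.cong refl) (simp add: degree_in_def sum_distrib_left)
  also have "\<dots> = (\<Sum>v\<in>Poly_Mapping.keys m. y (fst v) * Poly_Mapping.lookup m v)"
    by (rule sum.group) (use assms in \<open>auto simp: plucker_vars_def\<close>)
  finally show ?thesis by simp
qed

lemma card_rows:
  assumes "I \<subseteq> {..<n}" shows "card {i. i < n \<and> i \<in> I} = card I"
  using assms by (intro arg_cong[of _ _ card]) auto

lemma submatrix_carrier:
  assumes "B \<in> carrier_mat n d" "I \<subseteq> {..<n}"
  shows "submatrix B I UNIV \<in> carrier_mat (card I) d"
  using assms(1) card_rows[OF assms(2)] by (intro carrier_matI) (simp_all add: dim_submatrix)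

lemma submatrix_rows_index:
  assumes "B \<in> carrier_mat n d" "I \<subseteq> {..<n}" "r < card I" "c < d"
  shows "submatrix B I UNIV $$ (r, c) = B $$ (pick I r, c)" "pick I r < n"
proof -
  show "submatrix B I UNIV $$ (r, c) = B $$ (pick I r, c)"
    using assms(1,3,4) card_rows[OF assms(2)] by (subst submatrix_index) (simp_all add: pick_UNIV)
  show "pick I r < n" using pick_le[of r n I] assms(3) card_rows[OF assms(2)] by simp
qed

lemma minor_mult:
  fixes B :: "'a::field mat"
  assumes B: "B \<in> carrier_mat n d" and H: "H \<in> carrier_mat d d" and I: "I \<subseteq> {..<n}" "card I = d"
  shows "det (submatrix (B * H) I UNIV) = det (submatrix B I UNIV) * det H"
proof -
  have BH: "B * H \<in> carrier_mat n d" using B H by simp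
  have "submatrix (B * H) I UNIV = submatrix B I UNIV * H"
  proof (rule eq_matI)
    fix r c assume "r < dim_row (submatrix B I UNIV * H)" "c < dim_col (submatrix B I UNIV * H)"
    then have rc: "r < card I" "c < d" using submatrix_carrier[OF B I(1)] H by auto
    have "row (submatrix B I UNIV) r = row B (pick I r)"
      using submatrix_carrier[OF B I(1)] B rc submatrix_rows_index[OF B I(1) rc(1)]
      by (intro eq_vecI) auto
    then show "submatrix (B * H) I UNIV $$ (r, c) = (submatrix B I UNIV * H) $$ (r, c)"
      using submatrix_rows_index[OF BH I(1) rc] submatrix_carrier[OF B I(1)] B H rc by simp
  qed (use submatrix_carrier[OF BH I(1)] submatrix_carrier[OF B I(1)] H in auto)
  then show ?thesis using det_mult[of "submatrix B I UNIV" d H] submatrix_carrier[OF B I(1)] I H by simp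
qed

text \<open>
  A change of frame multiplies all Pluecker coordinates of the \<open>i\<close>-th factor by \<open>det (H i)\<close>, hence
  every monomial of a multihomogeneous polynomial by the same product of powers of these
  determinants.
\<close>

lemma poly_eval_frame_change:
  fixes F :: "((nat \<times> nat set) \<Rightarrow>\<^sub>0 nat) \<Rightarrow>\<^sub>0 'a::field"
  assumes F: "multihomogeneous n ds F"
    and B: "\<And>i. i < length ds \<Longrightarrow> B i \<in> carrier_mat n (ds ! i)"
    and H: "\<And>i. i < length ds \<Longrightarrow> H i \<in> carrier_mat (ds ! i) (ds ! i)"
    and B': "\<And>i. i < length ds \<Longrightarrow> B' i = B i * H i"
  shows "\<exists>c. poly_eval (plucker B') F = c * poly_eval (plucker B) F"
proof -
  obtain e where keys: "\<And>m. m \<in> Poly_Mapping.keys F \<Longrightarrow> Poly_Mapping.keys m \<subseteq> plucker_vars n ds"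
    and e: "\<And>m i. m \<in> Poly_Mapping.keys F \<Longrightarrow> i < length ds \<Longrightarrow> degree_in i m = e i"
    using F unfolding multihomogeneous_iff by blast
  let ?c = "\<Prod>i<length ds. det (H i) ^ e i"
  have "monomial_eval (plucker B') m = ?c * monomial_eval (plucker B) m" if m: "m \<in> Poly_Mapping.keys F" for m
  proof -
    have "plucker B' v = det (H (fst v)) * plucker B v" if vm: "v \<in> Poly_Mapping.keys m" for v
    proof -
      obtain i I where v: "v = (i, I)" "i < length ds" "I \<subseteq> {..<n}" "card I = ds ! i"
        using plucker_varsE[of v n ds] keys[OF m] vm by blast
      then show ?thesis using minor_mult[OF B H v(3,4)] B' by (simp add: plucker_def)
    qed
    then have "monomial_eval (plucker B') m
      = (\<Prod>v\<in>Poly_Mapping.keys m. det (H (fst v)) ^ Poly_Mapping.lookup m v) * monomial_eval (plucker B) m"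
      unfolding monomial_eval_def by (simp add: power_mult_distrib prod.distrib)
    also have "(\<Prod>v\<in>Poly_Mapping.keys m. det (H (fst v)) ^ Poly_Mapping.lookup m v) = ?c"
      using prod_by_factor[OF keys[OF m], of "\<lambda>i. det (H i)"] e[OF m] by simp
    finally show ?thesis .
  qed
  then have "poly_eval (plucker B') F = ?c * poly_eval (plucker B) F"
    unfolding poly_eval_eq sum_distrib_left by (intro sum.cong refl) (simp add: mult_ac)
  then show ?thesis by blast
qed

lemma hompoly_plucker_monomial:
  fixes M :: "('v \<Rightarrow> 'a::field) \<Rightarrow> nat \<Rightarrow> 'a mat"
  assumes M: "\<And>x i. i < length ds \<Longrightarrow> M x i \<in> carrier_mat n (ds ! i)"
    and lin: "\<And>i r c. i < length ds \<Longrightarrow> r < n \<Longrightarrow> c < ds ! i \<Longrightarrow> hompoly V 1 (\<lambda>x. M x i $$ (r, c))"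
    and m: "Poly_Mapping.keys m \<subseteq> plucker_vars n ds"
  shows "hompoly V (\<Sum>i<length ds. ds ! i * degree_in i m) (\<lambda>x. monomial_eval (plucker (M x)) m)"
proof -
  have "hompoly V (ds ! fst v) (\<lambda>x. plucker (M x) v)" if vm: "v \<in> plucker_vars n ds" for v
  proof -
    obtain i I where v: "v = (i, I)" "i < length ds" "I \<subseteq> {..<n}" "card I = ds ! i"
      using plucker_varsE[OF vm] by blast
    have "hompoly V (ds ! i) (\<lambda>x. det (submatrix (M x i) I UNIV))"
    proof (rule hompoly_det)
      show "submatrix (M x i) I UNIV \<in> carrier_mat (ds ! i) (ds ! i)" for x
        using submatrix_carrier[OF M v(3), of i x] v by simp
      fix r c assume "r < ds ! i" "c < ds ! i"
      then show "hompoly V 1 (\<lambda>x. submatrix (M x i) I UNIV $$ (r, c))"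
        using submatrix_rows_index[OF M[OF v(2)] v(3), of r c] lin[OF v(2), of "pick I r" c] v by simp
    qed
    then show ?thesis by (simp add: v plucker_def)
  qed
  then have "hompoly V (\<Sum>v\<in>Poly_Mapping.keys m. ds ! fst v * Poly_Mapping.lookup m v)
      (\<lambda>x. monomial_eval (plucker (M x)) m)"
    unfolding monomial_eval_def using m by (intro hompoly_prod hompoly_power) blast
  then show ?thesis using sum_by_factor[OF m, of "\<lambda>i. ds ! i"] by simp
qed

lemma hompoly_plucker:
  fixes F :: "((nat \<times> nat set) \<Rightarrow>\<^sub>0 nat) \<Rightarrow>\<^sub>0 'a::field"
  assumes M: "\<And>x i. i < length ds \<Longrightarrow> M x i \<in> carrier_mat n (ds ! i)"
    and lin: "\<And>i r c. i < length ds \<Longrightarrow> r < n \<Longrightarrow> c < ds ! i \<Longrightarrow> hompoly V 1 (\<lambda>x. M x i $$ (r, c))"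
    and F: "multihomogeneous n ds F"
  shows "\<exists>k. hompoly V k (\<lambda>x. poly_eval (plucker (M x)) F)"
proof -
  obtain e where keys: "\<And>m. m \<in> Poly_Mapping.keys F \<Longrightarrow> Poly_Mapping.keys m \<subseteq> plucker_vars n ds"
    and e: "\<And>m i. m \<in> Poly_Mapping.keys F \<Longrightarrow> i < length ds \<Longrightarrow> degree_in i m = e i"
    using F unfolding multihomogeneous_iff by blast
  have "hompoly V (\<Sum>i<length ds. ds ! i * e i) (\<lambda>x. poly_eval (plucker (M x)) F)"
    unfolding poly_eval_eq
  proof (intro hompoly_sum hompoly_smult)
    fix m assume m: "m \<in> Poly_Mapping.keys F"
    show "hompoly V (\<Sum>i<length ds. ds ! i * e i) (\<lambda>x. monomial_eval (plucker (M x)) m)"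
      using hompoly_plucker_monomial[where M=M, OF M lin keys[OF m]] e[OF m] by simp
  qed
  then show ?thesis by blast
qed


section \<open>An infinitesimal criterion for density\<close>

definition matrices :: "nat \<Rightarrow> nat list \<Rightarrow> (nat \<times> nat \<times> nat \<Rightarrow> 'a) \<Rightarrow> nat \<Rightarrow> 'a mat" where
  "matrices n ds x i = mat n (ds ! i) (\<lambda>(r, c). x (i, r, c))"

lemma matrices_carrier [simp]: "matrices n ds x i \<in> carrier_mat n (ds ! i)"
  by (simp add: matrices_def)

text \<open>
  Pulled back to matrices, every nonempty open set contains the nonvanishing locus of a single
  nonzero polynomial. For a finite intersection one takes the product, which is nonzero by
  irreducibility.
\<close>

lemma zariski_open_contains_hompoly_locus:
  fixes U :: "(nat \<Rightarrow> 'a::field vec set) set"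
  assumes inf: "infinite (UNIV :: 'a set)"
    and "generate_topology_on {nonvanishing n ds F | F. multihomogeneous n ds F} U" and "U \<noteq> {}"
  shows "\<exists>k f x. hompoly UNIV k f \<and> f x \<noteq> 0 \<and>
    (\<forall>y. spanned n ds (matrices n ds y) \<in> Gr_prod n ds \<longrightarrow> f y \<noteq> 0 \<longrightarrow> spanned n ds (matrices n ds y) \<in> U)"
  using assms(2,3)
proof induction
  case Empty then show ?case by simp
next
  case (Int a b)
  from Int.prems have "a \<noteq> {}" "b \<noteq> {}" by blast+
  from Int.IH(1)[OF this(1)] obtain k f x where f: "hompoly UNIV k f" "f x \<noteq> 0"
    "\<forall>y. spanned n ds (matrices n ds y) \<in> Gr_prod n ds \<longrightarrow> f y \<noteq> 0 \<longrightarrow> spanned n ds (matrices n ds y) \<in> a"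
    by blast
  from Int.IH(2)[OF \<open>b \<noteq> {}\<close>] obtain l g x' where g: "hompoly UNIV l g" "g x' \<noteq> 0"
    "\<forall>y. spanned n ds (matrices n ds y) \<in> Gr_prod n ds \<longrightarrow> g y \<noteq> 0 \<longrightarrow> spanned n ds (matrices n ds y) \<in> b"
    by blast
  obtain z where z: "f z * g z \<noteq> 0" using hompoly_mult_nonzero[where f = f and g = g and x = x and y = x', OF inf f(1) g(1) f(2) g(2)] by blast
  show ?case
    by (intro exI[of _ "k + l"] exI[of _ "\<lambda>x. f x * g x"] exI[of _ z])
      (use z hompoly.mult[OF f(1) g(1)] f(3) g(3) in auto)
next
  case (UN K)
  then obtain a where "a \<in> K" "a \<noteq> {}" by blast
  with UN.IH[OF this] show ?case by blast
next
  case (Basis s)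
  then obtain F where F: "s = nonvanishing n ds F" "multihomogeneous n ds F" by blast
  from Basis(2) F obtain B W where B: "\<And>i. i < length ds \<Longrightarrow> B i \<in> frames (ds ! i) n (W i)"
    and nz: "poly_eval (plucker B) F \<noteq> 0" unfolding nonvanishing_def by blast
  have Bc: "B i \<in> carrier_mat n (ds ! i)" if "i < length ds" for i using B[OF that] by (simp add: frames_def)
  define x where "x = (\<lambda>(i, r, c). B i $$ (r, c))"
  have Bx: "B i = matrices n ds x i * 1\<^sub>m (ds ! i)" if "i < length ds" for i
    using Bc[OF that] by (auto simp: matrices_def x_def)
  obtain c where "poly_eval (plucker B) F = c * poly_eval (plucker (matrices n ds x)) F"
    using poly_eval_frame_change[OF F(2), of "matrices n ds x" "\<lambda>i. 1\<^sub>m (ds ! i)" B] Bx by auto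
  with nz have "poly_eval (plucker (matrices n ds x)) F \<noteq> 0" by auto
  moreover have "\<exists>k. hompoly UNIV k (\<lambda>x. poly_eval (plucker (matrices n ds x)) F)"
    by (rule hompoly_plucker[OF _ _ F(2)]) (auto simp: matrices_def intro: hompoly.var[unfolded One_nat_def])
  moreover have "spanned n ds (matrices n ds y) \<in> s"
    if "spanned n ds (matrices n ds y) \<in> Gr_prod n ds" "poly_eval (plucker (matrices n ds y)) F \<noteq> 0" for y
    unfolding F(1) nonvanishing_def using that
    by (intro CollectI conjI exI[of _ "matrices n ds y"]) (auto simp: frames_def spanned_def)
  ultimately show ?case by blast
qed

lemma det_one_plus_poly:
  fixes X :: "nat \<Rightarrow> nat \<Rightarrow> 'a::field"
  shows "\<exists>p. poly p 0 = 1 \<and> (\<forall>t. det (mat d d (\<lambda>(r, c). (if r = c then 1 else 0) + t * X r c)) = poly p t)"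
proof -
  have "hompoly UNIV d (\<lambda>y. det (mat d d (\<lambda>(r, c). y (r, c) :: 'a)))"
    by (rule hompoly_det) (auto intro: hompoly.var[unfolded One_nat_def])
  then obtain p where p: "\<And>t. det (mat d d (\<lambda>(r, c). poly [:if r = c then 1 else 0, X r c:] t)) = poly p t"
    using hompoly_curve[of UNIV d _ "\<lambda>(r, c). [:if r = c then 1 else 0, X r c:]"] by fastforce
  have "mat d d (\<lambda>(r, c). if r = c then 1 else 0 :: 'a) = 1\<^sub>m d" by (auto simp: one_mat_def)
  then have "poly p 0 = 1" using p[of 0] by simp
  then show ?thesis using p by (intro exI[of _ p]) simp
qed

text \<open>
  The hypothesis \<open>trans\<close> says that the differential \<open>(X, H) \<mapsto> (X C\<^sub>i + C\<^sub>i H\<^sub>i)\<^sub>i\<close> of the action of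
  \<open>GL(n) \<times> \<Prod> GL(d\<^sub>i)\<close> on tuples of frames is surjective at \<open>C\<close>. If the orbit missed a nonempty open
  set, some nonzero polynomial would vanish on all frames of its points, in particular on
  \<open>(1 + t X) C\<^sub>i (1 + t H\<^sub>i)\<close> for almost all \<open>t\<close>. By surjectivity these curves have every possible
  tangent at \<open>C\<close>, so the polynomial would be zero.
\<close>

lemma dense_if_infinitesimally_transitive:
  fixes C :: "nat \<Rightarrow> nat \<Rightarrow> nat \<Rightarrow> 'a::field"
  assumes inf: "infinite (UNIV :: 'a set)"
    and inj: "\<And>i v. i < length ds \<Longrightarrow> \<forall>r<n. (\<Sum>c<ds ! i. C i r c * v c) = 0 \<Longrightarrow> \<forall>c<ds ! i. v c = 0"
    and trans: "\<And>Y. \<exists>X H. \<forall>i<length ds. \<forall>r<n. \<forall>c<ds ! i.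
      (\<Sum>k<n. X r k * C i k c) + (\<Sum>k<ds ! i. C i r k * H i k c) = Y i r c"
  shows "dense_dim_vector TYPE('a) n ds"
proof -
  define C' where "C' = (\<lambda>(i, r, c). C i r c)"
  define M where "M = matrices n ds C'"
  have Mc: "M i \<in> carrier_mat n (ds ! i)" for i by (simp add: M_def)
  have Minj: "injective_mat (M i)" if i: "i < length ds" for i
    unfolding injective_mat_def
  proof (intro ballI impI)
    fix v :: "'a vec" assume v: "v \<in> carrier_vec (dim_col (M i))" and 0: "M i *\<^sub>v v = 0\<^sub>v (dim_row (M i))"
    have "(\<Sum>c<ds ! i. C i r c * v $ c) = 0" if "r < n" for r
    proof -
      have "(M i *\<^sub>v v) $ r = (\<Sum>c<ds ! i. C i r c * v $ c)"
        using v that Mc[of i]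
        by (auto simp: M_def matrices_def C'_def scalar_prod_def lessThan_atLeast0 intro!: sum.cong)
      then show ?thesis using 0 Mc[of i] that by simp
    qed
    then have "\<forall>c<ds ! i. v $ c = 0" using inj[OF i, of "\<lambda>c. v $ c"] by blast
    then show "v = 0\<^sub>v (dim_col (M i))" using v Mc[of i] by (intro eq_vecI) auto
  qed
  let ?W = "spanned n ds M"
  have W: "?W \<in> Gr_prod n ds" using spanned_in_Gr_prod Mc Minj by blast
  have "orbit (PGL TYPE('a) n) (diag_act ds) ?W \<inter> U \<noteq> {}"
    if open_U: "openin (zariski n ds) U" and ne: "U \<noteq> {}" for U
  proof
    assume disj: "orbit (PGL TYPE('a) n) (diag_act ds) ?W \<inter> U = {}"
    obtain k f x where f: "hompoly UNIV k f" "f x \<noteq> 0"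
      "\<And>y. spanned n ds (matrices n ds y) \<in> Gr_prod n ds \<Longrightarrow> f y \<noteq> 0 \<Longrightarrow> spanned n ds (matrices n ds y) \<in> U"
      using zariski_open_contains_hompoly_locus[OF inf _ ne] open_U
      unfolding zariski_def openin_topology_generated_by_iff by blast
    have "\<exists>Z. \<forall>t. f (\<lambda>v. C' v + t * (Y v + t * Z v)) = 0" for Y
    proof -
      obtain X H where XH: "\<And>i r c. i < length ds \<Longrightarrow> r < n \<Longrightarrow> c < ds ! i \<Longrightarrow>
          (\<Sum>k<n. X r k * C i k c) + (\<Sum>k<ds ! i. C i r k * H i k c) = Y (i, r, c)"
        using trans[of "\<lambda>i r c. Y (i, r, c)"] by blast
      \<comment> \<open>The curve \<open>(1 + t X) C\<^sub>i (1 + t H\<^sub>i)\<close> is \<open>C\<^sub>i + t Y\<^sub>i + t\<^sup>2 Z\<^sub>i\<close>.\<close>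
      define Z where "Z = (\<lambda>(i, r, c). \<Sum>l<ds ! i. (\<Sum>k<n. X r k * C i k l) * H i l c)"
      define curve where "curve = (\<lambda>t v. C' v + t * (Y v + t * Z v))"
      define A where "A = (\<lambda>t. mat n n (\<lambda>(r, c). (if r = c then 1 else 0) + t * X r c))"
      define K where "K = (\<lambda>i t. mat (ds ! i) (ds ! i) (\<lambda>(r, c). (if r = c then 1 else 0) + t * H i r c))"
      have Ac: "A t \<in> carrier_mat n n" and Kc: "K i t \<in> carrier_mat (ds ! i) (ds ! i)" for i t
        by (simp_all add: A_def K_def)
      have curve: "matrices n ds (curve t) i = A t * M i * K i t" if i: "i < length ds" for i t
      proof (rule eq_matI)
        fix r c assume "r < dim_row (A t * M i * K i t)" "c < dim_col (A t * M i * K i t)"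
        then have rc: "r < n" "c < ds ! i" by (auto simp: A_def K_def)
        have AM: "(A t * M i) $$ (r, l) = C i r l + t * (\<Sum>k<n. X r k * C i k l)" if l: "l < ds ! i" for l
        proof -
          have "(A t * M i) $$ (r, l) = (\<Sum>k<n. ((if r = k then 1 else 0) + t * X r k) * C i k l)"
            using rc l by (auto simp: A_def M_def matrices_def C'_def scalar_prod_def lessThan_atLeast0 intro!: sum.cong)
          also have "\<dots> = (\<Sum>k<n. if r = k then C i k l else 0) + (\<Sum>k<n. t * (X r k * C i k l))"
            unfolding sum.distrib[symmetric] by (rule sum.cong) (auto simp: algebra_simps)
          finally show ?thesis using rc by (simp add: sum_distrib_left)
        qed
        have "(A t * M i * K i t) $$ (r, c)
          = (\<Sum>l<ds ! i. (A t * M i) $$ (r, l) * ((if l = c then 1 else 0) + t * H i l c))"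
          using rc Ac[of t] Mc[of i]
          by (auto simp: K_def scalar_prod_def lessThan_atLeast0 intro!: sum.cong)
        also have "\<dots> = (\<Sum>l<ds ! i. if l = c then C i l c * 0 + (C i r l + t * (\<Sum>k<n. X r k * C i k l)) else 0)
            + (\<Sum>l<ds ! i. t * (C i r l * H i l c))
            + (\<Sum>l<ds ! i. t * (t * ((\<Sum>k<n. X r k * C i k l) * H i l c)))"
          unfolding sum.distrib[symmetric] by (rule sum.cong) (auto simp: AM algebra_simps)
        also have "\<dots> = C i r c + t * ((\<Sum>k<n. X r k * C i k c) + (\<Sum>l<ds ! i. C i r l * H i l c))
            + t * (t * Z (i, r, c))"
          using rc by (simp add: sum_distrib_left[symmetric] Z_def algebra_simps)
        also have "\<dots> = curve t (i, r, c)"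
          using XH[OF i rc] by (simp add: curve_def C'_def algebra_simps)
        finally show "matrices n ds (curve t) i $$ (r, c) = (A t * M i * K i t) $$ (r, c)"
          using rc by (simp add: matrices_def)
      qed (auto simp: A_def K_def matrices_def)
      obtain p where p: "\<And>t. f (curve t) = poly p t"
        using hompoly_curve[OF f(1), of "\<lambda>v. [:C' v, Y v, Z v:]"] by (auto simp: curve_def)
      obtain q where q: "poly q 0 = 1" "\<And>t. det (A t) = poly q t"
        using det_one_plus_poly[of n X] unfolding A_def by blast
      have "\<exists>p. poly p 0 = 1 \<and> (\<forall>t. det (K i t) = poly p t)" for i
        using det_one_plus_poly[of "ds ! i" "H i"] unfolding K_def by blast
      then obtain h where h: "\<And>i. poly (h i) 0 = 1" "\<And>i t. det (K i t) = poly (h i) t" by metis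
      \<comment> \<open>The factor \<open>e\<close> vanishes at the finitely many \<open>t\<close> where \<open>1 + t X\<close> or some \<open>1 + t H\<^sub>i\<close> is singular;
        it is not the zero polynomial because all determinants are 1 at \<open>t = 0\<close>.\<close>
      define e where "e = q * (\<Prod>i<length ds. h i)"
      have "poly (p * e) t = 0" for t
      proof (rule ccontr)
        assume "poly (p * e) t \<noteq> 0"
        then have ft: "f (curve t) \<noteq> 0" and dA: "det (A t) \<noteq> 0"
          and dK: "\<And>i. i < length ds \<Longrightarrow> det (K i t) \<noteq> 0"
          using p q h by (auto simp: e_def poly_prod)
        have sp: "spanned n ds (matrices n ds (curve t)) = spanned n ds (\<lambda>i. A t * M i)"
          unfolding spanned_def
          using col_space_mult_right[OF mult_carrier_mat[OF Ac Mc] Kc dK] curve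
          by (auto simp: fun_eq_iff restrict_def)
        have "spanned n ds (matrices n ds (curve t)) \<in> Gr_prod n ds"
        proof (rule spanned_in_Gr_prod)
          show "injective_mat (matrices n ds (curve t) i)" if "i < length ds" for i
            using injective_mat_mult[OF Ac dA Mc Minj[OF that] Kc dK[OF that]] curve[OF that] by simp
        qed simp
        then have "spanned n ds (\<lambda>i. A t * M i) \<in> U" using f(3) ft sp by metis
        moreover have "spanned n ds (\<lambda>i. A t * M i) \<in> orbit (PGL TYPE('a) n) (diag_act ds) ?W"
          unfolding orbit_spanned[OF Mc] using Ac dA by blast
        ultimately show False using disj by blast
      qed
      then have "p * e = 0" using poly_zero_cofinite[OF inf] by blast
      moreover have "poly e 0 = 1" using q h by (simp add: e_def poly_prod)
      then have "e \<noteq> 0" by auto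
      ultimately have "p = 0" by simp
      then show ?thesis using p by (intro exI[of _ Z]) (simp add: curve_def)
    qed
    then have "f x = 0" using hompoly_lowest_term[OF inf f(1), of C'] by blast
    then show False using f(2) by simp
  qed
  then have "zariski n ds closure_of (orbit (PGL TYPE('a) n) (diag_act ds) ?W) = topspace (zariski n ds)"
    unfolding dense_intersects_open by blast
  then show ?thesis unfolding dense_dim_vector_def topspace_zariski using W by blast
qed


section \<open>Points and planes with at most two relations\<close>

text \<open>
  The criterion with the sums over the columns of a frame written out; the points have the indices
  below \<open>a\<close>.
\<close>

lemma dense_points_planes:
  fixes C :: "nat \<Rightarrow> nat \<Rightarrow> nat \<Rightarrow> 'a::field"
  assumes inf: "infinite (UNIV :: 'a set)"
    and points: "\<And>i. i < a \<Longrightarrow> \<exists>r<n. C i r 0 \<noteq> 0"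
    and planes: "\<And>i u v. a \<le> i \<Longrightarrow> i < a + b \<Longrightarrow> \<forall>r<n. C i r 0 * u + C i r 1 * v = 0 \<Longrightarrow> u = 0 \<and> v = 0"
    and trans: "\<And>Y :: nat \<Rightarrow> nat \<Rightarrow> nat \<Rightarrow> 'a. \<exists>X (H :: nat \<Rightarrow> nat \<Rightarrow> nat \<Rightarrow> 'a). \<forall>r<n.
      (\<forall>i<a. (\<Sum>k<n. X r k * C i k 0) + C i r 0 * H i 0 0 = Y i r 0) \<and>
      (\<forall>i. a \<le> i \<longrightarrow> i < a + b \<longrightarrow>
        (\<Sum>k<n. X r k * C i k 0) + (C i r 0 * H i 0 0 + C i r 1 * H i 1 0) = Y i r 0 \<and>
        (\<Sum>k<n. X r k * C i k 1) + (C i r 0 * H i 0 1 + C i r 1 * H i 1 1) = Y i r 1)"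
  shows "dense_dim_vector TYPE('a) n (replicate a 1 @ replicate b 2)"
proof (rule dense_if_infinitesimally_transitive[OF inf, where C = C])
  let ?ds = "replicate a 1 @ replicate b 2 :: nat list"
  have len: "length ?ds = a + b" by simp
  have nth: "?ds ! i = (if i < a then 1 else 2)" if "i < a + b" for i
    using that by (auto simp: nth_append)
  fix i v assume i: "i < length ?ds" and 0: "\<forall>r<n. (\<Sum>c<?ds ! i. C i r c * v c) = 0"
  show "\<forall>c<?ds ! i. v c = 0"
  proof (cases "i < a")
    case True
    then have "\<forall>r<n. C i r 0 * v 0 = 0" using 0 nth[of i] by simp
    then show ?thesis using points[OF True] nth[of i] True by auto
  next
    case False
    then have "\<forall>r<n. C i r 0 * v 0 + C i r 1 * v 1 = 0" using 0 nth[of i] i by (simp add: numeral_2_eq_2)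
    then show ?thesis using planes[of i "v 0" "v 1"] nth[of i] False i by (auto simp: less_2_cases_iff)
  qed
next
  let ?ds = "replicate a 1 @ replicate b 2 :: nat list"
  have nth: "?ds ! i = (if i < a then 1 else 2)" if "i < a + b" for i
    using that by (auto simp: nth_append)
  fix Y :: "nat \<Rightarrow> nat \<Rightarrow> nat \<Rightarrow> 'a"
  obtain X and H :: "nat \<Rightarrow> nat \<Rightarrow> nat \<Rightarrow> 'a" where XH: "\<forall>r<n.
      (\<forall>i<a. (\<Sum>k<n. X r k * C i k 0) + C i r 0 * H i 0 0 = Y i r 0) \<and>
      (\<forall>i. a \<le> i \<longrightarrow> i < a + b \<longrightarrow>
        (\<Sum>k<n. X r k * C i k 0) + (C i r 0 * H i 0 0 + C i r 1 * H i 1 0) = Y i r 0 \<and>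
        (\<Sum>k<n. X r k * C i k 1) + (C i r 0 * H i 0 1 + C i r 1 * H i 1 1) = Y i r 1)"
    using trans[of Y] by blast
  have "(\<Sum>k<n. X r k * C i k c) + (\<Sum>k<?ds ! i. C i r k * H i k c) = Y i r c"
    if "i < length ?ds" "r < n" "c < ?ds ! i" for i r c
  proof (cases "i < a")
    case True
    then show ?thesis using XH that nth[of i] by simp
  next
    case False
    then have "a \<le> i" "i < a + b" "c = 0 \<or> c = 1" using that nth[of i] by (auto simp: less_2_cases_iff)
    then show ?thesis using XH that(2) nth[of i] by (auto simp: numeral_2_eq_2)
  qed
  then show "\<exists>X H. \<forall>i<length ?ds. \<forall>r<n. \<forall>c<?ds ! i.
      (\<Sum>k<n. X r k * C i k c) + (\<Sum>k<?ds ! i. C i r k * H i k c) = Y i r c" by blast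
qed

text \<open>
  The number of the basis vector that spans direction \<open>c\<close> of the \<open>i\<close>-th subspace when the points and
  the planes are placed, in this order, on disjoint sets of basis vectors.
\<close>

definition slot :: "nat \<Rightarrow> nat \<Rightarrow> nat \<Rightarrow> nat" where
  "slot a i c = (if i < a then i else a + 2 * (i - a) + c)"

text \<open>
  All subspaces but the last plane are spanned by disjoint sets of basis vectors, with the last basis
  vector left over. The last plane is spanned by this vector and by the sum \<open>\<sigma>\<close> of all the others. The
  matrix \<open>X\<close> may be prescribed on the basis; the one remaining condition, on \<open>X \<sigma>\<close>, is met by
  rescaling the basis vectors, which only moves them inside their subspaces.
\<close>

lemma dense_at_most_one_relation:
  assumes inf: "infinite (UNIV :: 'a::field set)" and b: "1 \<le> b" and n: "2 \<le> n" "a + 2 * b \<le> n + 1"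
  shows "dense_dim_vector TYPE('a) n (replicate a 1 @ replicate b 2)"
proof -
  define l where "l = a + b - 1"
  define m where "m = a + 2 * (b - 1)"
  have m: "m < n" using n b by (simp add: m_def)
  have slot_less: "slot a i c < m" if "i < l" "c < 2" for i c
    using that b by (auto simp: slot_def m_def l_def)
  have l: "a \<le> l" "l < a + b" using b by (auto simp: l_def)
  define C :: "nat \<Rightarrow> nat \<Rightarrow> nat \<Rightarrow> 'a" where
    "C = (\<lambda>i r c. if i = l then (if c = 0 then (if r = n - 1 then 1 else 0) else (if r < n - 1 then 1 else 0))
       else (if r = slot a i c then 1 else 0))"
  show ?thesis
  proof (rule dense_points_planes[OF inf, where C = C])
    fix i assume "i < a"
    then show "\<exists>r<n. C i r 0 \<noteq> 0" using slot_less[of i 0] m l by (intro exI[of _ "slot a i 0"]) (auto simp: C_def)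
  next
    fix i u v assume i: "a \<le> i" "i < a + b" and 0: "\<forall>r<n. C i r 0 * u + C i r 1 * v = 0"
    show "u = 0 \<and> v = 0"
    proof (cases "i = l")
      case True
      then show ?thesis using 0[rule_format, of 0] 0[rule_format, of "n - 1"] m n b
        by (auto simp: C_def)
    next
      case False
      then have "i < l" using i b by (auto simp: l_def)
      then show ?thesis
        using 0[rule_format, of "slot a i 0"] 0[rule_format, of "slot a i 1"] slot_less[of i 0] slot_less[of i 1] m i
        by (auto simp: C_def slot_def)
    qed
  next
    fix Y :: "nat \<Rightarrow> nat \<Rightarrow> nat \<Rightarrow> 'a"
    define y where "y = (\<lambda>j r. if j < a then Y j r 0 else if j < m then Y (a + (j - a) div 2) r ((j - a) mod 2)
      else if j = n - 1 then Y l r 0 else 0)"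
    \<comment> \<open>\<open>w\<close> is the error in \<open>X \<sigma>\<close> when \<open>X\<close> is read off from \<open>Y\<close>. Its component at the basis vector \<open>j\<close>
      is removed by subtracting a multiple of that vector from its image, and the component at
      \<open>n - 1\<close> lies in the last plane.\<close>
    define w where "w = (\<lambda>r. (\<Sum>j<n - 1. y j r) - Y l r 1)"
    define X where "X = (\<lambda>r j. y j r - (if r = j \<and> j < n - 1 then w j else 0))"
    define H where "H = (\<lambda>i k c. if i = l then (if k = 0 \<and> c = 1 then - w (n - 1) else 0)
      else (if k = c then w (slot a i c) else (0::'a)))"
    have y_slot: "y (slot a i c) r = Y i r c" if "i < l" "c < 2" "i < a \<longrightarrow> c = 0" for i c r
      using slot_less[OF that(1,2)] that by (auto simp: y_def slot_def)
    have X_slot: "(\<Sum>k<n. X r k * C i k c) = Y i r c - (if r = slot a i c then w r else 0)"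
      if "i < l" "c < 2" "i < a \<longrightarrow> c = 0" "r < n" for i c r
    proof -
      have "(\<Sum>k<n. X r k * C i k c) = (\<Sum>k<n. if k = slot a i c then X r k else 0)"
        using that by (intro sum.cong) (auto simp: C_def)
      also have "\<dots> = X r (slot a i c)" using slot_less[OF that(1,2)] m by simp
      finally show ?thesis using y_slot[OF that(1-3)] slot_less[OF that(1,2)] m by (auto simp: X_def)
    qed
    have X_l0: "(\<Sum>k<n. X r k * C l k 0) = Y l r 0" for r
    proof -
      have "(\<Sum>k<n. X r k * C l k 0) = (\<Sum>k<n. if k = n - 1 then X r k else 0)"
        by (intro sum.cong) (auto simp: C_def)
      also have "\<dots> = Y l r 0" using m by (auto simp: X_def y_def m_def)
      finally show ?thesis .
    qed
    have X_l1: "(\<Sum>k<n. X r k * C l k 1) = Y l r 1 + (if r = n - 1 then w r else 0)" if "r < n" for r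
    proof -
      have "(\<Sum>k<n. X r k * C l k 1) = (\<Sum>k<n - 1. X r k)"
        by (intro sum.mono_neutral_cong_right) (auto simp: C_def)
      also have "\<dots> = (\<Sum>k<n - 1. y k r) - (\<Sum>k<n - 1. if r = k then w k else 0)"
        unfolding sum_subtractf[symmetric] by (intro sum.cong) (auto simp: X_def)
      finally show ?thesis using that by (auto simp: w_def)
    qed
    show "\<exists>X (H :: nat \<Rightarrow> nat \<Rightarrow> nat \<Rightarrow> 'a). \<forall>r<n.
      (\<forall>i<a. (\<Sum>k<n. X r k * C i k 0) + C i r 0 * H i 0 0 = Y i r 0) \<and>
      (\<forall>i. a \<le> i \<longrightarrow> i < a + b \<longrightarrow>
        (\<Sum>k<n. X r k * C i k 0) + (C i r 0 * H i 0 0 + C i r 1 * H i 1 0) = Y i r 0 \<and>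
        (\<Sum>k<n. X r k * C i k 1) + (C i r 0 * H i 0 1 + C i r 1 * H i 1 1) = Y i r 1)"
    proof (intro exI[of _ X] exI[of _ H] allI impI conjI)
      fix r i assume r: "r < n" and i: "i < a"
      then show "(\<Sum>k<n. X r k * C i k 0) + C i r 0 * H i 0 0 = Y i r 0"
        using X_slot[of i 0 r] l by (auto simp: C_def H_def)
    next
      fix r i assume r: "r < n" and i: "a \<le> i" "i < a + b"
      show "(\<Sum>k<n. X r k * C i k 0) + (C i r 0 * H i 0 0 + C i r 1 * H i 1 0) = Y i r 0"
      proof (cases "i = l")
        case True then show ?thesis using X_l0 by (simp add: H_def)
      next
        case False
        then have "i < l" using i by (auto simp: l_def)
        then show ?thesis using X_slot[of i 0 r] r i by (auto simp: C_def H_def)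
      qed
      show "(\<Sum>k<n. X r k * C i k 1) + (C i r 0 * H i 0 1 + C i r 1 * H i 1 1) = Y i r 1"
      proof (cases "i = l")
        case True then show ?thesis using X_l1[OF r] by (auto simp: H_def C_def)
      next
        case False
        then have "i < l" using i by (auto simp: l_def)
        then show ?thesis using X_slot[of i 1 r] r i by (auto simp: C_def H_def)
      qed
    qed
  qed
qed

lemma half_eq_iff:
  fixes q d :: nat
  shows "d div 2 = q \<longleftrightarrow> d = 2 * q \<or> d = 2 * q + 1"
    and "q = d div 2 \<and> even d \<longleftrightarrow> d = 2 * q"
    and "q = d div 2 \<and> odd d \<longleftrightarrow> d = 2 * q + 1"
  by presburger+

text \<open>
  Now the other subspaces use up the whole basis, and the last plane is spanned by two vectors \<open>s\<close> and
  \<open>u\<close> whose components in the \<open>j\<close>-th plane are its two basis vectors. As before \<open>X\<close> is prescribed on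
  the basis, and what remains are conditions on \<open>X s\<close> and \<open>X u\<close>. Their components in a plane can be
  corrected by a motion inside that plane. A point with components \<open>(s\<^sub>j, u\<^sub>j)\<close> can only be rescaled,
  which corrects one of its two components; the other one has to be matched by a change of basis
  \<open>\<alpha>, \<beta>, \<gamma>\<close> in the last plane. The components \<open>(s\<^sub>j : u\<^sub>j)\<close> of at most three points are the points
  \<open>0, \<infinity>, 1\<close> of the projective line, on which these changes of basis act infinitesimally transitively.
  For four points a cross-ratio would appear here.
\<close>

lemma dense_two_relations:
  assumes inf: "infinite (UNIV :: 'a::field set)" and b: "1 \<le> b" and a: "a \<le> 3" and n3: "3 \<le> n"
    and n: "a + 2 * b = n + 2"
  shows "dense_dim_vector TYPE('a) n (replicate a 1 @ replicate b 2)"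
proof -
  define l where "l = a + b - 1"
  have na: "n = a + 2 * (b - 1)" using n b by simp
  have l: "a \<le> l" "l < a + b" using b by (auto simp: l_def)
  have slot_less: "slot a i c < n" if "i < l" "c < 2" for i c
    using that b by (auto simp: slot_def na l_def)
  define s :: "nat \<Rightarrow> 'a" where "s = (\<lambda>j. if j < a then (if j = 1 then 0 else 1) else if even (j - a) then 1 else 0)"
  define u :: "nat \<Rightarrow> 'a" where "u = (\<lambda>j. if j < a then (if j = 0 then 0 else 1) else if even (j - a) then 0 else 1)"
  define C :: "nat \<Rightarrow> nat \<Rightarrow> nat \<Rightarrow> 'a" where
    "C = (\<lambda>i r c. if i = l then (if c = 0 then s r else u r) else (if r = slot a i c then 1 else 0))"
  show ?thesis
  proof (rule dense_points_planes[OF inf, where C = C])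
    fix i assume "i < a"
    then show "\<exists>r<n. C i r 0 \<noteq> 0" using slot_less[of i 0] l by (intro exI[of _ "slot a i 0"]) (auto simp: C_def)
  next
    fix i x y assume i: "a \<le> i" "i < a + b" and 0: "\<forall>r<n. C i r 0 * x + C i r 1 * y = 0"
    show "x = 0 \<and> y = 0"
    proof (cases "i = l")
      case True
      show ?thesis
      proof (cases "2 \<le> a")
        case True2: True
        then show ?thesis using 0[rule_format, of 0] 0[rule_format, of 1] True n3
          by (simp add: C_def s_def u_def)
      next
        case False
        then have "a + 1 < n" using n3 by simp
        then show ?thesis using 0[rule_format, of a] 0[rule_format, of "a + 1"] True
          by (simp add: C_def s_def u_def)
      qed
    next
      case False
      then have "i < l" using i b by (auto simp: l_def)
      then show ?thesis
        using 0[rule_format, of "slot a i 0"] 0[rule_format, of "slot a i 1"] slot_less[of i 0] slot_less[of i 1] i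
        by (auto simp: C_def slot_def)
    qed
  next
    fix Y :: "nat \<Rightarrow> nat \<Rightarrow> nat \<Rightarrow> 'a"
    define y where "y = (\<lambda>j r. if j < a then Y j r 0 else Y (a + (j - a) div 2) r ((j - a) mod 2))"
    define ws where "ws = (\<lambda>r. (\<Sum>j<n. y j r * s j) - Y l r 0)"
    define wu where "wu = (\<lambda>r. (\<Sum>j<n. y j r * u j) - Y l r 1)"
    \<comment> \<open>The coefficients \<open>\<beta>\<close>, \<open>\<gamma>\<close> and \<open>\<alpha>\<close> are dictated by the points 1, 0 and 2 respectively. If these
      points are present, \<open>R 1 = 0\<close>, \<open>Q 0 = 0\<close> and \<open>R 2 = Q 2\<close>.\<close>
    define \<beta> where "\<beta> = - ws 1"
    define \<gamma> where "\<gamma> = - wu 0"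
    define \<alpha> where "\<alpha> = wu 2 + \<gamma> - ws 2 - \<beta>"
    \<comment> \<open>\<open>R\<close> and \<open>Q\<close> are the errors in \<open>X s\<close> and \<open>X u\<close> after the change of basis in the last plane; the
      correction \<open>K\<close> of \<open>X\<close> and the motions \<open>H\<close> inside the other subspaces remove them.\<close>
    define R where "R = (\<lambda>r. ws r + (s r * \<alpha> + u r * \<beta>))"
    define Q where "Q = (\<lambda>r. wu r + s r * \<gamma>)"
    define h where "h = (\<lambda>j. if j = (1::nat) then Q j else R j)"
    define K where "K = (\<lambda>r j. if j < a then (if r = j then h j else 0)
      else if a \<le> r \<and> (r - a) div 2 = (j - a) div 2 then (if even (j - a) then R r else Q r) else 0)"
    define X where "X = (\<lambda>r j. y j r - K r j)"
    define H where "H = (\<lambda>i k c. if i = l then (if c = 0 then (if k = 0 then \<alpha> else \<beta>) else (if k = 0 then \<gamma> else 0))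
      else if i < a then h i else if c = (0::nat) then R (slot a i k) else Q (slot a i k))"
    have y_slot: "y (slot a i c) r = Y i r c" if "c < 2" "i < a \<longrightarrow> c = 0" for i c r
      using that by (auto simp: y_def slot_def)
    have X_slot: "(\<Sum>k<n. X r k * C i k c) = Y i r c - K r (slot a i c)"
      if "i < l" "c < 2" "i < a \<longrightarrow> c = 0" for i c r
    proof -
      have "(\<Sum>k<n. X r k * C i k c) = (\<Sum>k<n. if k = slot a i c then X r k else 0)"
        using that by (intro sum.cong) (auto simp: C_def)
      also have "\<dots> = X r (slot a i c)" using slot_less[OF that(1,2)] by simp
      finally show ?thesis using y_slot[OF that(2,3)] by (simp add: X_def)
    qed
    have K_plane: "K r (slot a i c) = C i r 0 * H i 0 c + C i r 1 * H i 1 c"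
      if "a \<le> i" "i < l" "c < 2" for i r c
    proof -
      have "a \<le> r \<and> (r - a) div 2 = i - a \<longleftrightarrow> r = a + 2 * (i - a) \<or> r = a + 2 * (i - a) + 1"
        unfolding half_eq_iff(1) by auto
      then show ?thesis using that by (auto simp: K_def slot_def C_def H_def less_2_cases_iff)
    qed
    have Ks: "K r k * s k = (if k = (if r < a then r else a + 2 * ((r - a) div 2)) then R r else 0)" for r k
    proof (cases "k < a")
      case True
      have "R 1 = 0" if "1 < a" using that by (simp add: R_def s_def u_def \<beta>_def)
      then show ?thesis using True by (auto simp: K_def s_def h_def)
    next
      case False
      have iff: "a \<le> r \<and> (r - a) div 2 = (k - a) div 2 \<and> even (k - a) \<longleftrightarrow> a \<le> r \<and> k = a + 2 * ((r - a) div 2)"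
      proof -
        have "k - a = 2 * q \<longleftrightarrow> k = a + 2 * q" for q using False by auto
        then show ?thesis by (simp only: half_eq_iff(2))
      qed
      have "K r k * s k = (if a \<le> r \<and> (r - a) div 2 = (k - a) div 2 \<and> even (k - a) then R r else 0)"
        using False by (simp add: K_def s_def)
      also have "\<dots> = (if k = (if r < a then r else a + 2 * ((r - a) div 2)) then R r else 0)"
        unfolding iff using False by (cases "r < a") simp_all
      finally show ?thesis .
    qed
    have Ku: "K r k * u k = (if k = (if r < a then r else a + 2 * ((r - a) div 2) + 1) then Q r else 0)" for r k
    proof (cases "k < a")
      case True
      have "Q 0 = 0" if "0 < a" using that by (simp add: Q_def s_def \<gamma>_def)
      moreover have "R 2 = Q 2" if "2 < a" using that by (simp add: R_def Q_def s_def u_def \<alpha>_def)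
      moreover have "k = 0 \<or> k = 1 \<or> k = 2" using True a by auto
      ultimately show ?thesis using True by (auto simp: K_def u_def h_def)
    next
      case False
      have iff: "a \<le> r \<and> (r - a) div 2 = (k - a) div 2 \<and> odd (k - a) \<longleftrightarrow> a \<le> r \<and> k = a + 2 * ((r - a) div 2) + 1"
      proof -
        have "k - a = 2 * q + 1 \<longleftrightarrow> k = a + 2 * q + 1" for q using False by auto
        then show ?thesis by (simp only: half_eq_iff(3))
      qed
      have "K r k * u k = (if a \<le> r \<and> (r - a) div 2 = (k - a) div 2 \<and> odd (k - a) then Q r else 0)"
        using False by (simp add: K_def u_def)
      also have "\<dots> = (if k = (if r < a then r else a + 2 * ((r - a) div 2) + 1) then Q r else 0)"
        unfolding iff using False by (cases "r < a") simp_all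
      finally show ?thesis .
    qed
    have X_l0: "(\<Sum>k<n. X r k * C l k 0) = Y l r 0 - (s r * \<alpha> + u r * \<beta>)" if r: "r < n" for r
    proof -
      have "(if r < a then r else a + 2 * ((r - a) div 2)) < n" using r by auto
      then have "(\<Sum>k<n. K r k * s k) = R r" unfolding Ks by simp
      moreover have "(\<Sum>k<n. X r k * C l k 0) = (\<Sum>k<n. y k r * s k) - (\<Sum>k<n. K r k * s k)"
        unfolding sum_subtractf[symmetric] by (intro sum.cong) (auto simp: X_def C_def algebra_simps)
      ultimately show ?thesis by (simp add: R_def ws_def)
    qed
    have X_l1: "(\<Sum>k<n. X r k * C l k 1) = Y l r 1 - s r * \<gamma>" if r: "r < n" for r
    proof -
      have "(if r < a then r else a + 2 * ((r - a) div 2) + 1) < n"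
      proof (cases "r < a")
        case False
        have "(r - a) div 2 < b - 1" using r na False by (intro less_mult_imp_div_less) simp
        then show ?thesis using False na by simp
      qed (use r in simp)
      then have "(\<Sum>k<n. K r k * u k) = Q r" unfolding Ku by simp
      moreover have "(\<Sum>k<n. X r k * C l k 1) = (\<Sum>k<n. y k r * u k) - (\<Sum>k<n. K r k * u k)"
        unfolding sum_subtractf[symmetric] by (intro sum.cong) (auto simp: X_def C_def algebra_simps)
      ultimately show ?thesis by (simp add: Q_def wu_def)
    qed
    show "\<exists>X (H :: nat \<Rightarrow> nat \<Rightarrow> nat \<Rightarrow> 'a). \<forall>r<n.
      (\<forall>i<a. (\<Sum>k<n. X r k * C i k 0) + C i r 0 * H i 0 0 = Y i r 0) \<and>
      (\<forall>i. a \<le> i \<longrightarrow> i < a + b \<longrightarrow>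
        (\<Sum>k<n. X r k * C i k 0) + (C i r 0 * H i 0 0 + C i r 1 * H i 1 0) = Y i r 0 \<and>
        (\<Sum>k<n. X r k * C i k 1) + (C i r 0 * H i 0 1 + C i r 1 * H i 1 1) = Y i r 1)"
    proof (intro exI[of _ X] exI[of _ H] allI impI conjI)
      fix r i assume r: "r < n" and i: "i < a"
      then show "(\<Sum>k<n. X r k * C i k 0) + C i r 0 * H i 0 0 = Y i r 0"
        using X_slot[of i 0 r] l by (auto simp: C_def H_def K_def slot_def)
    next
      fix r i assume r: "r < n" and i: "a \<le> i" "i < a + b"
      show "(\<Sum>k<n. X r k * C i k 0) + (C i r 0 * H i 0 0 + C i r 1 * H i 1 0) = Y i r 0"
      proof (cases "i = l")
        case True then show ?thesis using X_l0[OF r] by (simp add: H_def C_def)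
      next
        case False
        then have "i < l" using i by (auto simp: l_def)
        then show ?thesis using X_slot[of i 0 r] K_plane[of i 0 r] i by simp
      qed
      show "(\<Sum>k<n. X r k * C i k 1) + (C i r 0 * H i 0 1 + C i r 1 * H i 1 1) = Y i r 1"
      proof (cases "i = l")
        case True then show ?thesis using X_l1[OF r] by (auto simp: H_def C_def)
      next
        case False
        then have "i < l" using i by (auto simp: l_def)
        then show ?thesis using X_slot[of i 1 r] K_plane[of i 1 r] i by simp
      qed
    qed
  qed
qed


section \<open>Sporadic dense configurations\<close>

lemma all_less_small:
  "(\<forall>r<3. P r) \<longleftrightarrow> P 0 \<and> P 1 \<and> P (2::nat)"
  "(\<forall>r<4. P r) \<longleftrightarrow> P 0 \<and> P 1 \<and> P 2 \<and> P (3::nat)"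
  "(\<forall>r<5. P r) \<longleftrightarrow> P 0 \<and> P 1 \<and> P 2 \<and> P 3 \<and> P (4::nat)"
  "(\<forall>i. 1 \<le> i \<longrightarrow> i < 1 + 3 \<longrightarrow> P i) \<longleftrightarrow> P 1 \<and> P 2 \<and> P (3::nat)"
proof -
  have cases: "r < 3 \<Longrightarrow> r = 0 \<or> r = 1 \<or> r = 2" for r :: nat by arith
  show "(\<forall>r<3. P r) \<longleftrightarrow> P 0 \<and> P 1 \<and> P (2::nat)"
    by (rule iffI, simp, intro allI impI, drule cases, elim disjE, simp_all)
  have cases: "r < 4 \<Longrightarrow> r = 0 \<or> r = 1 \<or> r = 2 \<or> r = 3" for r :: nat by arith
  show "(\<forall>r<4. P r) \<longleftrightarrow> P 0 \<and> P 1 \<and> P 2 \<and> P (3::nat)"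
    by (rule iffI, simp, intro allI impI, drule cases, elim disjE, simp_all)
  have cases: "r < 5 \<Longrightarrow> r = 0 \<or> r = 1 \<or> r = 2 \<or> r = 3 \<or> r = 4" for r :: nat by arith
  show "(\<forall>r<5. P r) \<longleftrightarrow> P 0 \<and> P 1 \<and> P 2 \<and> P 3 \<and> P (4::nat)"
    by (rule iffI, simp, intro allI impI, drule cases, elim disjE, simp_all)
  have cases: "1 \<le> r \<Longrightarrow> r < 1 + 3 \<Longrightarrow> r = 1 \<or> r = 2 \<or> r = 3" for r :: nat by arith
  show "(\<forall>i. 1 \<le> i \<longrightarrow> i < 1 + 3 \<longrightarrow> P i) \<longleftrightarrow> P 1 \<and> P 2 \<and> P (3::nat)"
    by (rule iffI, simp, intro allI impI, drule (1) cases, elim disjE, simp_all)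
qed

lemma sum_less_small:
  "(\<Sum>k<3. f k) = f 0 + f 1 + f (2::nat)"
  "(\<Sum>k<4. f k) = f 0 + f 1 + f 2 + f (3::nat)"
  "(\<Sum>k<5. f k) = f 0 + f 1 + f 2 + f 3 + f (4::nat)"
  by (simp_all add: numeral_eq_Suc)

text \<open>
  Three coordinate planes and the plane \<open>x + y + z = 0\<close>. The coordinate planes prescribe the entries of
  \<open>X\<close> off the diagonal; the fourth plane prescribes the differences of the column sums, which are
  adjusted by the diagonal entries. Fewer planes impose fewer conditions.
\<close>

lemma dense_planes_in_3space:
  assumes inf: "infinite (UNIV :: 'a::field set)" and b: "b \<le> 4"
  shows "dense_dim_vector TYPE('a) 3 (replicate 0 1 @ replicate b 2)"
proof -
  define C :: "nat \<Rightarrow> nat \<Rightarrow> nat \<Rightarrow> 'a" where "C = (\<lambda>i r c. [[[0, 0], [1, 0], [0, 1]], [[1, 0], [0, 0], [0, 1]],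
     [[1, 0], [0, 1], [0, 0]], [[1, 0], [0, 1], [-1, -1]]] ! i ! r ! c)"
  show ?thesis
  proof (rule dense_points_planes[OF inf, where C = C])
    fix i u v assume "i < 0 + b" "\<forall>r<3. C i r 0 * u + C i r 1 * v = 0"
    moreover from this b have "i = 0 \<or> i = 1 \<or> i = 2 \<or> i = 3" by auto
    ultimately show "u = 0 \<and> v = 0" by (elim disjE) (simp_all add: all_less_small C_def)
  next
    fix Y :: "nat \<Rightarrow> nat \<Rightarrow> nat \<Rightarrow> 'a"
    define x where "x = (\<lambda>r c. [[0, Y 0 0 0, Y 0 0 1], [Y 1 1 0, 0, Y 1 1 1], [Y 2 2 0, Y 2 2 1, 0]] ! r ! c)"
    define f where "f = (\<lambda>j. x 0 j + x 1 j + x 2 j)"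
    define g where "g = (\<lambda>j. if j < 2 then Y 3 0 j + Y 3 1 j + Y 3 2 j + f 2 - f j else 0)"
    define X where "X = (\<lambda>r c. if r = c then g r else x r c)"
    define H where "H = (\<lambda>i k c.
      [Y 0 ([1, 2] ! k) c - X ([1, 2] ! k) ([1, 2] ! c), Y 1 ([0, 2] ! k) c - X ([0, 2] ! k) ([0, 2] ! c), Y 2 k c - X k c,
       Y 3 k c - (X k c - X k 2)] ! i)"
    have "\<forall>r<3. \<forall>i<4.
        (\<Sum>k<3. X r k * C i k 0) + (C i r 0 * H i 0 0 + C i r 1 * H i 1 0) = Y i r 0 \<and>
        (\<Sum>k<3. X r k * C i k 1) + (C i r 0 * H i 0 1 + C i r 1 * H i 1 1) = Y i r 1"
      unfolding all_less_small sum_less_small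
      by (simp add: C_def H_def X_def x_def g_def f_def)
    then show "\<exists>X (H :: nat \<Rightarrow> nat \<Rightarrow> nat \<Rightarrow> 'a). \<forall>r<3.
      (\<forall>i<0. (\<Sum>k<3. X r k * C i k 0) + C i r 0 * H i 0 0 = Y i r 0) \<and>
      (\<forall>i. 0 \<le> i \<longrightarrow> i < 0 + b \<longrightarrow>
        (\<Sum>k<3. X r k * C i k 0) + (C i r 0 * H i 0 0 + C i r 1 * H i 1 0) = Y i r 0 \<and>
        (\<Sum>k<3. X r k * C i k 1) + (C i r 0 * H i 0 1 + C i r 1 * H i 1 1) = Y i r 1)"
      using b by (intro exI[of _ X] exI[of _ H]) (auto dest: less_le_trans)
  qed simp
qed

text \<open>
  Three coordinate planes and the point \<open>(1, 1, 1)\<close>: again the planes prescribe the entries of \<open>X\<close> off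
  the diagonal, and the point prescribes the row sums.
\<close>

lemma dense_point_three_planes_in_3space:
  assumes inf: "infinite (UNIV :: 'a::field set)"
  shows "dense_dim_vector TYPE('a) 3 (replicate 1 1 @ replicate 3 2)"
proof -
  define C :: "nat \<Rightarrow> nat \<Rightarrow> nat \<Rightarrow> 'a" where "C = (\<lambda>i r c. [[[1], [1], [1]],
     [[0, 0], [1, 0], [0, 1]], [[1, 0], [0, 0], [0, 1]], [[1, 0], [0, 1], [0, 0]]] ! i ! r ! c)"
  show ?thesis
  proof (rule dense_points_planes[OF inf, where C = C])
    fix i :: nat assume "i < 1"
    then show "\<exists>r<3. C i r 0 \<noteq> 0" by (intro exI[of _ 0]) (simp add: C_def)
  next
    fix i u v assume "1 \<le> i" "i < 1 + 3" "\<forall>r<3. C i r 0 * u + C i r 1 * v = 0"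
    moreover from this have "i = 1 \<or> i = 2 \<or> i = 3" by arith
    ultimately show "u = 0 \<and> v = 0" by (elim disjE) (simp_all add: all_less_small C_def)
  next
    fix Y :: "nat \<Rightarrow> nat \<Rightarrow> nat \<Rightarrow> 'a"
    define x where "x = (\<lambda>r c. [[0, Y 1 0 0, Y 1 0 1], [Y 2 1 0, 0, Y 2 1 1], [Y 3 2 0, Y 3 2 1, 0]] ! r ! c)"
    define X where "X = (\<lambda>r c. if r = c then Y 0 r 0 - (x r 0 + x r 1 + x r 2) else x r c)"
    define H where "H = (\<lambda>i k c.
      [0, Y 1 ([1, 2] ! k) c - X ([1, 2] ! k) ([1, 2] ! c), Y 2 ([0, 2] ! k) c - X ([0, 2] ! k) ([0, 2] ! c), Y 3 k c - X k c] ! i)"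
    show "\<exists>X (H :: nat \<Rightarrow> nat \<Rightarrow> nat \<Rightarrow> 'a). \<forall>r<3.
      (\<forall>i<1. (\<Sum>k<3. X r k * C i k 0) + C i r 0 * H i 0 0 = Y i r 0) \<and>
      (\<forall>i. 1 \<le> i \<longrightarrow> i < 1 + 3 \<longrightarrow>
        (\<Sum>k<3. X r k * C i k 0) + (C i r 0 * H i 0 0 + C i r 1 * H i 1 0) = Y i r 0 \<and>
        (\<Sum>k<3. X r k * C i k 1) + (C i r 0 * H i 0 1 + C i r 1 * H i 1 1) = Y i r 1)"
      unfolding all_less_small sum_less_small
      by (intro exI[of _ X] exI[of _ H]) (simp add: C_def H_def X_def x_def)
  qed
qed

text \<open>
  Write the space as \<open>U \<oplus> U\<close> with \<open>dim U = 2\<close>. The planes are \<open>U \<oplus> 0\<close>, \<open>0 \<oplus> U\<close> and the diagonal; their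
  common stabilizer is \<open>GL(U)\<close> acting on both summands. The components of the point are the two basis
  vectors of \<open>U\<close>, and \<open>GL(U)\<close> acts simply transitively on bases.
\<close>

lemma dense_point_three_planes_in_4space:
  assumes inf: "infinite (UNIV :: 'a::field set)"
  shows "dense_dim_vector TYPE('a) 4 (replicate 1 1 @ replicate 3 2)"
proof -
  define C :: "nat \<Rightarrow> nat \<Rightarrow> nat \<Rightarrow> 'a" where "C = (\<lambda>i r c. [[[1], [0], [0], [1]],
     [[1, 0], [0, 1], [0, 0], [0, 0]], [[0, 0], [0, 0], [1, 0], [0, 1]], [[1, 0], [0, 1], [1, 0], [0, 1]]] ! i ! r ! c)"
  show ?thesis
  proof (rule dense_points_planes[OF inf, where C = C])
    fix i :: nat assume "i < 1"
    then show "\<exists>r<4. C i r 0 \<noteq> 0" by (intro exI[of _ 0]) (simp add: C_def)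
  next
    fix i u v assume "1 \<le> i" "i < 1 + 3" "\<forall>r<4. C i r 0 * u + C i r 1 * v = 0"
    moreover from this have "i = 1 \<or> i = 2 \<or> i = 3" by arith
    ultimately show "u = 0 \<and> v = 0" by (elim disjE) (simp_all add: all_less_small C_def)
  next
    fix Y :: "nat \<Rightarrow> nat \<Rightarrow> nat \<Rightarrow> 'a"
    define x00 where "x00 = Y 0 0 0 - Y 2 0 1"
    define x23 where "x23 = Y 0 2 0 - Y 1 2 0"
    define x01 where "x01 = x23 - Y 3 2 1 + Y 3 0 1 + Y 1 2 1 - Y 2 0 1"
    define x22 where "x22 = Y 3 2 0 - Y 3 0 0 - Y 1 2 0 + x00 + Y 2 0 0"
    define x10 where "x10 = Y 0 1 0 - Y 2 1 1"
    define x33 where "x33 = Y 0 3 0 - Y 1 3 0"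
    define x11 where "x11 = x33 - Y 3 3 1 + Y 3 1 1 + Y 1 3 1 - Y 2 1 1"
    define x32 where "x32 = Y 3 3 0 - Y 3 1 0 - Y 1 3 0 + x10 + Y 2 1 0"
    define X where "X = (\<lambda>r c.
      [[x00, x01, Y 2 0 0, Y 2 0 1],
       [x10, x11, Y 2 1 0, Y 2 1 1],
       [Y 1 2 0, Y 1 2 1, x22, x23],
       [Y 1 3 0, Y 1 3 1, x32, x33]] ! r ! c)"
    have X: "X 0 0 = x00" "X 0 1 = x01" "X 0 2 = Y 2 0 0" "X 0 3 = Y 2 0 1"
      "X 1 0 = x10" "X 1 1 = x11" "X 1 2 = Y 2 1 0" "X 1 3 = Y 2 1 1"
      "X 2 0 = Y 1 2 0" "X 2 1 = Y 1 2 1" "X 2 2 = x22" "X 2 3 = x23"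
      "X 3 0 = Y 1 3 0" "X 3 1 = Y 1 3 1" "X 3 2 = x32" "X 3 3 = x33"
      by (simp_all add: X_def)
    note X = X[unfolded One_nat_def]
    \<comment> \<open>The columns of \<open>E i\<close> have to lie in the \<open>i\<close>-th subspace; \<open>H i\<close> then collects their coordinates.\<close>
    define E where "E = (\<lambda>i r c. Y i r c - (\<Sum>k<4. X r k * C i k c))"
    define H where "H = (\<lambda>i k c. [0, E 1 k c, E 2 ([2, 3] ! k) c, E 3 k c] ! i)"
    have "E 0 0 0 = 0" "E 0 1 0 = 0" "E 0 2 0 = 0" "E 0 3 0 = 0"
      by (simp_all add: E_def C_def sum_less_small X x00_def x10_def x23_def x33_def)
    moreover have "E 1 2 c = 0" "E 1 3 c = 0" "E 2 0 c = 0" "E 2 1 c = 0" if "c = 0 \<or> c = 1" for c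
      using that by (elim disjE; simp add: E_def C_def sum_less_small X)+
    moreover have "E 3 2 c = E 3 0 c" "E 3 3 c = E 3 1 c" if "c = 0 \<or> c = 1" for c
      using that by (elim disjE; simp add: E_def C_def sum_less_small X x01_def x11_def x22_def x32_def)+
    ultimately have "\<forall>r<4. (\<forall>i<1. C i r 0 * H i 0 0 = E i r 0) \<and>
        (\<forall>i. 1 \<le> i \<longrightarrow> i < 1 + 3 \<longrightarrow>
          C i r 0 * H i 0 0 + C i r 1 * H i 1 0 = E i r 0 \<and> C i r 0 * H i 0 1 + C i r 1 * H i 1 1 = E i r 1)"
      unfolding all_less_small by (simp add: C_def H_def)
    then show "\<exists>X (H :: nat \<Rightarrow> nat \<Rightarrow> nat \<Rightarrow> 'a). \<forall>r<4.
      (\<forall>i<1. (\<Sum>k<4. X r k * C i k 0) + C i r 0 * H i 0 0 = Y i r 0) \<and>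
      (\<forall>i. 1 \<le> i \<longrightarrow> i < 1 + 3 \<longrightarrow>
        (\<Sum>k<4. X r k * C i k 0) + (C i r 0 * H i 0 0 + C i r 1 * H i 1 0) = Y i r 0 \<and>
        (\<Sum>k<4. X r k * C i k 1) + (C i r 0 * H i 0 1 + C i r 1 * H i 1 1) = Y i r 1)"
      by (intro exI[of _ X] exI[of _ H]) (simp add: E_def)
  qed
qed

text \<open>
  The four planes in 5-space correspond to four points in general position in the projective plane:
  the three linear relations between the planes form a 3-dimensional space, and each of the four
  projections of this space to a plane has a 1-dimensional kernel. The configuration below comes
  from the points \<open>(1, 0, 0)\<close>, \<open>(0, 1, 0)\<close>, \<open>(0, 0, 1)\<close>, \<open>(1, 1, 1)\<close>. Up to the scalar matrices, the
  linear system for \<open>X\<close> is triangular with coefficients \<open>\<plusminus>1\<close>, so it is solvable over every field.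
\<close>

lemma dense_four_planes_in_5space:
  assumes inf: "infinite (UNIV :: 'a::field set)"
  shows "dense_dim_vector TYPE('a) 5 (replicate 0 1 @ replicate 4 2)"
proof -
  define C :: "nat \<Rightarrow> nat \<Rightarrow> nat \<Rightarrow> 'a" where "C = (\<lambda>i r c.
    [[[1, 0], [0, 1], [0, 1], [0, 1], [0, 1]], [[0, 0], [1, 0], [0, 1], [0, 0], [0, 0]],
     [[0, 0], [0, 0], [0, 0], [1, 0], [0, 1]], [[0, 1], [1, 0], [0, 1], [1, 0], [0, 0]]] ! i ! r ! c)"
  show ?thesis
  proof (rule dense_points_planes[OF inf, where C = C])
    fix i u v assume "i < 0 + (4::nat)" "\<forall>r<5. C i r 0 * u + C i r 1 * v = 0"
    moreover from this have "i = 0 \<or> i = 1 \<or> i = 2 \<or> i = 3" by auto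
    ultimately show "u = 0 \<and> v = 0" by (elim disjE) (simp_all add: all_less_small C_def)
  next
    fix Y :: "nat \<Rightarrow> nat \<Rightarrow> nat \<Rightarrow> 'a"
    define x33 where "x33 = Y 2 1 0 - Y 1 3 0 + Y 3 3 0 - Y 3 1 0"
    define x21 where "x21 = Y 3 2 0 - Y 3 0 0 + Y 1 0 0 + Y 2 0 0 - Y 2 2 0"
    define x43 where "x43 = Y 3 4 0 - Y 1 4 0"
    define x40 where "x40 = Y 3 4 1 - Y 1 4 1"
    define x10 where "x10 = x40 - Y 0 4 0 + Y 0 1 0"
    define x20 where "x20 = x10 + Y 0 2 0 - Y 0 1 0"
    define x30 where "x30 = x10 + Y 0 3 0 - Y 0 1 0"
    define x12 where "x12 = x30 + Y 1 3 1 - x10 - Y 3 3 1 + Y 3 1 1"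
    define w where "w = x12 + Y 2 1 0 + Y 2 1 1 - Y 0 1 1"
    define x22 where "x22 = w + Y 0 2 1 - x21 - Y 2 2 0 - Y 2 2 1"
    define x34 where "x34 = w + Y 0 3 1 - Y 1 3 0 - Y 1 3 1 - x33"
    define x44 where "x44 = w + Y 0 4 1 - Y 1 4 0 - Y 1 4 1 - x43"
    define x00 where "x00 = x20 + x22 - Y 1 0 1 - Y 3 2 1 + Y 3 0 1"
    define X where "X = (\<lambda>r c.
      [[x00, Y 1 0 0, Y 1 0 1, Y 2 0 0, Y 2 0 1],
       [x10, 0, x12, Y 2 1 0, Y 2 1 1],
       [x20, x21, x22, Y 2 2 0, Y 2 2 1],
       [x30, Y 1 3 0, Y 1 3 1, x33, x34],
       [x40, Y 1 4 0, Y 1 4 1, x43, x44]] ! r ! c)"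
    have X: "X 0 0 = x00" "X 0 1 = Y 1 0 0" "X 0 2 = Y 1 0 1" "X 0 3 = Y 2 0 0" "X 0 4 = Y 2 0 1"
      "X 1 0 = x10" "X 1 1 = 0" "X 1 2 = x12" "X 1 3 = Y 2 1 0" "X 1 4 = Y 2 1 1"
      "X 2 0 = x20" "X 2 1 = x21" "X 2 2 = x22" "X 2 3 = Y 2 2 0" "X 2 4 = Y 2 2 1"
      "X 3 0 = x30" "X 3 1 = Y 1 3 0" "X 3 2 = Y 1 3 1" "X 3 3 = x33" "X 3 4 = x34"
      "X 4 0 = x40" "X 4 1 = Y 1 4 0" "X 4 2 = Y 1 4 1" "X 4 3 = x43" "X 4 4 = x44"
      by (simp_all add: X_def)
    note X = X[unfolded One_nat_def]
    \<comment> \<open>The columns of \<open>E i\<close> have to lie in the \<open>i\<close>-th subspace; \<open>H i\<close> then collects their coordinates.\<close>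
    define E where "E = (\<lambda>i r c. Y i r c - (\<Sum>k<5. X r k * C i k c))"
    define H where "H = (\<lambda>i k c. [E 0 k c, E 1 ([1, 2] ! k) c, E 2 ([3, 4] ! k) c, E 3 ([1, 0] ! k) c] ! i)"
    have "E 0 r c = E 0 1 c" if "r = 2 \<or> r = 3 \<or> r = 4" "c = 0 \<or> c = 1" for r c
      using that
      by (elim disjE) (simp_all add: E_def C_def sum_less_small X x20_def x30_def x10_def x22_def x34_def x44_def w_def)
    moreover have "E 1 r c = 0" if "r = 0 \<or> r = 3 \<or> r = 4" "c = 0 \<or> c = 1" for r c
      using that by (elim disjE) (simp_all add: E_def C_def sum_less_small X)
    moreover have "E 2 r c = 0" if "r = 0 \<or> r = 1 \<or> r = 2" "c = 0 \<or> c = 1" for r c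
      using that by (elim disjE) (simp_all add: E_def C_def sum_less_small X)
    moreover have "E 3 3 c = E 3 1 c" "E 3 2 c = E 3 0 c" "E 3 4 c = 0" if "c = 0 \<or> c = 1" for c
      using that
      by (elim disjE; simp add: E_def C_def sum_less_small X x33_def x21_def x43_def x40_def x12_def x00_def)+
    ultimately have "\<forall>r<5. \<forall>i<4.
        C i r 0 * H i 0 0 + C i r 1 * H i 1 0 = E i r 0 \<and> C i r 0 * H i 0 1 + C i r 1 * H i 1 1 = E i r 1"
      unfolding all_less_small by (simp add: C_def H_def)
    then show "\<exists>X (H :: nat \<Rightarrow> nat \<Rightarrow> nat \<Rightarrow> 'a). \<forall>r<5.
      (\<forall>i<0. (\<Sum>k<5. X r k * C i k 0) + C i r 0 * H i 0 0 = Y i r 0) \<and>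
      (\<forall>i. 0 \<le> i \<longrightarrow> i < 0 + 4 \<longrightarrow>
        (\<Sum>k<5. X r k * C i k 0) + (C i r 0 * H i 0 0 + C i r 1 * H i 1 0) = Y i r 0 \<and>
        (\<Sum>k<5. X r k * C i k 1) + (C i r 0 * H i 0 1 + C i r 1 * H i 1 1) = Y i r 1)"
      by (intro exI[of _ X] exI[of _ H]) (simp add: E_def)
  qed simp
qed


section \<open>Counting coefficients\<close>

text \<open>
  Gaussian elimination, one equation at a time.
\<close>

lemma underdetermined_system_has_solution:
  fixes M :: "'s \<Rightarrow> 'e \<Rightarrow> 'a::field"
  assumes "finite E" "finite S" "card E < card S"
  shows "\<exists>c. (\<exists>s\<in>S. c s \<noteq> 0) \<and> (\<forall>e\<in>E. (\<Sum>s\<in>S. c s * M s e) = 0)"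
  using assms
proof (induction E arbitrary: S M rule: finite_induct)
  case empty
  then have "S \<noteq> {}" by auto
  then show ?case by (intro exI[of _ "\<lambda>_. 1"]) auto
next
  case (insert e E)
  show ?case
  proof (cases "\<forall>s\<in>S. M s e = 0")
    case True
    have "card E < card S" using insert by simp
    then obtain c where "\<exists>s\<in>S. c s \<noteq> 0" "\<forall>e\<in>E. (\<Sum>s\<in>S. c s * M s e) = 0"
      using insert.IH[OF insert.prems(1), of M] by blast
    then show ?thesis using True by (intro exI[of _ c]) auto
  next
    case False
    then obtain p where p: "p \<in> S" "M p e \<noteq> 0" by blast
    let ?S = "S - {p}"
    define N where "N = (\<lambda>s f. M s f - M s e / M p e * M p f)"
    have "card E < card ?S" using insert p by simp
    then obtain c where c: "\<exists>s\<in>?S. c s \<noteq> 0" "\<forall>f\<in>E. (\<Sum>s\<in>?S. c s * N s f) = 0"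
      using insert.IH[of ?S N] insert.prems by blast
    define c' where "c' = c(p := - (\<Sum>s\<in>?S. c s * (M s e / M p e)))"
    have sum: "(\<Sum>s\<in>S. c' s * M s f) = (\<Sum>s\<in>?S. c s * N s f)" for f
    proof -
      have "(\<Sum>s\<in>S. c' s * M s f) = c' p * M p f + (\<Sum>s\<in>?S. c' s * M s f)"
        using insert.prems(1) p(1) by (rule sum.remove)
      also have "(\<Sum>s\<in>?S. c' s * M s f) = (\<Sum>s\<in>?S. c s * M s f)"
        by (rule sum.cong) (auto simp: c'_def)
      also have "c' p * M p f = - (\<Sum>s\<in>?S. c s * (M s e / M p e * M p f))"
        by (simp add: c'_def sum_distrib_right mult.assoc)
      finally show ?thesis by (simp add: N_def sum_subtractf[symmetric] algebra_simps)
    qed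
    have "N s e = 0" for s using p by (simp add: N_def)
    then have "\<forall>f\<in>insert e E. (\<Sum>s\<in>S. c' s * M s f) = 0" unfolding sum using c(2) by auto
    moreover have "\<exists>s\<in>S. c' s \<noteq> 0" using c(1) by (auto simp: c'_def)
    ultimately show ?thesis by blast
  qed
qed

definition exponents :: "'v set \<Rightarrow> nat \<Rightarrow> ('v \<Rightarrow> nat) set" where
  "exponents V k = {\<alpha> \<in> V \<rightarrow>\<^sub>E {..k}. sum \<alpha> V = k}"

lemma finite_exponents: "finite V \<Longrightarrow> finite (exponents V k)"
  unfolding exponents_def by (rule finite_subset[OF _ finite_PiE[of V "\<lambda>_. {..k}"]]) auto

lemma exponentsI:
  assumes "finite V" "\<alpha> \<in> extensional V" "sum \<alpha> V = k"
  shows "\<alpha> \<in> exponents V k"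
proof -
  have "\<alpha> v \<le> k" if "v \<in> V" for v using member_le_sum[OF that, of \<alpha>] assms by simp
  then show ?thesis using assms by (auto simp: exponents_def PiE_iff)
qed

text \<open>
  One exponent is determined by the others. This loss of one variable reflects that scalar matrices
  act trivially.
\<close>

lemma card_exponents:
  assumes "finite V" "V \<noteq> {}"
  shows "card (exponents V k) \<le> (k + 1) ^ (card V - 1)"
proof -
  obtain v where v: "v \<in> V" using assms(2) by blast
  let ?V = "V - {v}"
  have "inj_on (\<lambda>\<alpha>. restrict \<alpha> ?V) (exponents V k)"
  proof (rule inj_onI)
    fix \<alpha> \<beta> assume \<alpha>: "\<alpha> \<in> exponents V k" and \<beta>: "\<beta> \<in> exponents V k"
      and eq: "restrict \<alpha> ?V = restrict \<beta> ?V"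
    have off: "\<alpha> w = \<beta> w" if "w \<in> ?V" for w using fun_cong[OF eq, of w] that by simp
    have "\<alpha> v + sum \<alpha> ?V = \<beta> v + sum \<beta> ?V"
      using \<alpha> \<beta> sum.remove[OF assms(1) v, of \<alpha>] sum.remove[OF assms(1) v, of \<beta>]
      by (simp add: exponents_def)
    moreover have "sum \<alpha> ?V = sum \<beta> ?V" using off by (rule sum.cong[OF refl])
    ultimately have "\<alpha> v = \<beta> v" by simp
    with off have "\<alpha> w = \<beta> w" if "w \<in> V" for w using that by (cases "w = v") auto
    then show "\<alpha> = \<beta>" using \<alpha> \<beta> unfolding exponents_def by (auto intro: PiE_ext)
  qed
  moreover have "(\<lambda>\<alpha>. restrict \<alpha> ?V) ` exponents V k \<subseteq> ?V \<rightarrow>\<^sub>E {..k}"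
    by (rule image_subsetI, unfold restrict_PiE_iff) (auto simp: exponents_def)
  ultimately have "card (exponents V k) \<le> card (?V \<rightarrow>\<^sub>E {..k})"
    using assms(1) by (intro card_inj_on_le[where f = "\<lambda>\<alpha>. restrict \<alpha> ?V"] finite_PiE) auto
  also have "\<dots> = (k + 1) ^ (card V - 1)" using assms(1) v by (simp add: card_PiE)
  finally show ?thesis .
qed

lemma hompoly_expand:
  fixes f :: "('v \<Rightarrow> 'a::field) \<Rightarrow> 'a"
  assumes "finite V" "hompoly V k f"
  shows "\<exists>c. \<forall>x. f x = (\<Sum>\<alpha>\<in>exponents V k. c \<alpha> * (\<Prod>v\<in>V. x v ^ \<alpha> v))"
  using assms(2)
proof induction
  case (zero k) show ?case by (rule exI[of _ "\<lambda>_. 0"]) simp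
next
  case (const c)
  have "exponents V 0 = {\<lambda>v\<in>V. 0}"
    using assms(1) by (auto simp: exponents_def PiE_iff extensional_def fun_eq_iff)
  then show ?case by (intro exI[of _ "\<lambda>_. c"]) simp
next
  case (var v)
  define \<epsilon> :: "'v \<Rightarrow> nat" where "\<epsilon> = (\<lambda>w\<in>V. if w = v then 1 else 0)"
  have \<epsilon>: "\<epsilon> \<in> exponents V 1" using assms(1) var by (intro exponentsI) (auto simp: \<epsilon>_def)
  have "(\<Prod>w\<in>V. x w ^ \<epsilon> w) = x v" for x :: "'v \<Rightarrow> 'a"
  proof -
    have "(\<Prod>w\<in>V. x w ^ \<epsilon> w) = (\<Prod>w\<in>V. if w = v then x w else 1)"
      by (rule prod.cong) (auto simp: \<epsilon>_def)
    then show ?thesis using assms(1) var by simp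
  qed
  then have "x v = (\<Sum>\<alpha>\<in>exponents V 1. (if \<alpha> = \<epsilon> then 1 else 0) * (\<Prod>v\<in>V. x v ^ \<alpha> v))" for x :: "'v \<Rightarrow> 'a"
    using \<epsilon> finite_exponents[OF assms(1)] by (simp add: if_distrib[where f = "\<lambda>u. u * _"] cong: if_cong)
  then show ?case by (intro exI[of _ "\<lambda>\<alpha>. if \<alpha> = \<epsilon> then 1 else 0"]) blast
next
  case (add k f g)
  then obtain c d where "\<forall>x. f x = (\<Sum>\<alpha>\<in>exponents V k. c \<alpha> * (\<Prod>v\<in>V. x v ^ \<alpha> v))"
    "\<forall>x. g x = (\<Sum>\<alpha>\<in>exponents V k. d \<alpha> * (\<Prod>v\<in>V. x v ^ \<alpha> v))" by blast
  then show ?case by (intro exI[of _ "\<lambda>\<alpha>. c \<alpha> + d \<alpha>"]) (simp add: distrib_right sum.distrib)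
next
  case (mult k f l g)
  then obtain c d where c: "\<forall>x. f x = (\<Sum>\<alpha>\<in>exponents V k. c \<alpha> * (\<Prod>v\<in>V. x v ^ \<alpha> v))"
    and d: "\<forall>x. g x = (\<Sum>\<alpha>\<in>exponents V l. d \<alpha> * (\<Prod>v\<in>V. x v ^ \<alpha> v))" by blast
  let ?S = "exponents V k \<times> exponents V l"
  define m where "m = (\<lambda>(\<alpha>, \<beta>). \<lambda>v\<in>V. \<alpha> v + \<beta> v :: nat)"
  have m: "m ` ?S \<subseteq> exponents V (k + l)"
  proof (intro image_subsetI exponentsI[OF assms(1)])
    fix s assume "s \<in> ?S"
    then show "m s \<in> extensional V" "sum (m s) V = k + l"
      by (auto simp: m_def exponents_def sum.distrib)
  qed
  have "f x * g x = (\<Sum>\<gamma>\<in>exponents V (k + l).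
      (\<Sum>s\<in>{s \<in> ?S. m s = \<gamma>}. c (fst s) * d (snd s)) * (\<Prod>v\<in>V. x v ^ \<gamma> v))" for x
  proof -
    have "f x * g x = (\<Sum>s\<in>?S. c (fst s) * d (snd s) * (\<Prod>v\<in>V. x v ^ m s v))"
      unfolding c[rule_format] d[rule_format] sum_product sum.cartesian_product
      by (rule sum.cong) (auto simp: m_def power_add prod.distrib mult_ac)
    also have "\<dots> = (\<Sum>\<gamma>\<in>exponents V (k + l).
      (\<Sum>s\<in>{s \<in> ?S. m s = \<gamma>}. c (fst s) * d (snd s) * (\<Prod>v\<in>V. x v ^ m s v)))"
      by (rule sum.group[symmetric, OF finite_cartesian_product finite_exponents m])
        (rule finite_exponents[OF assms(1)] assms(1))+
    also have "\<dots> = (\<Sum>\<gamma>\<in>exponents V (k + l).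
      (\<Sum>s\<in>{s \<in> ?S. m s = \<gamma>}. c (fst s) * d (snd s)) * (\<Prod>v\<in>V. x v ^ \<gamma> v))"
      unfolding sum_distrib_right by (intro sum.cong refl) auto
    finally show ?thesis .
  qed
  then show ?case by (intro exI[of _ "\<lambda>\<gamma>. \<Sum>s\<in>{s \<in> ?S. m s = \<gamma>}. c (fst s) * d (snd s)"]) blast
qed

text \<open>
  Polynomials with different coefficients are different functions, by induction on the number of
  variables and finiteness of the roots in the last one.
\<close>

lemma nonzero_coefficients_nonzero_value:
  fixes c :: "('v \<Rightarrow> nat) \<Rightarrow> 'a::field"
  assumes inf: "infinite (UNIV :: 'a set)" and "finite V"
    and "\<alpha> \<in> V \<rightarrow>\<^sub>E {..<q}" "c \<alpha> \<noteq> 0"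
  shows "\<exists>x. (\<Sum>\<alpha>\<in>V \<rightarrow>\<^sub>E {..<q}. c \<alpha> * (\<Prod>v\<in>V. x v ^ \<alpha> v)) \<noteq> 0"
  using assms(2-4)
proof (induction V arbitrary: c \<alpha> rule: finite_induct)
  case empty then show ?case by simp
next
  case (insert v V)
  define inner where "inner = (\<lambda>x k. \<Sum>\<beta>\<in>V \<rightarrow>\<^sub>E {..<q}. c (\<beta>(v := k)) * (\<Prod>w\<in>V. x w ^ \<beta> w))"
  have sum: "(\<Sum>\<alpha>\<in>insert v V \<rightarrow>\<^sub>E {..<q}. c \<alpha> * (\<Prod>w\<in>insert v V. x w ^ \<alpha> w)) = (\<Sum>k<q. inner x k * x v ^ k)" for x
  proof -
    have "(\<Sum>\<alpha>\<in>insert v V \<rightarrow>\<^sub>E {..<q}. c \<alpha> * (\<Prod>w\<in>insert v V. x w ^ \<alpha> w)) =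
      (\<Sum>(k, \<beta>)\<in>{..<q} \<times> (V \<rightarrow>\<^sub>E {..<q}). c (\<beta>(v := k)) * (\<Prod>w\<in>insert v V. x w ^ (\<beta>(v := k)) w))"
      unfolding PiE_insert_eq
      by (subst sum.reindex[OF inj_combinator[OF insert.hyps(2)]]) (simp add: case_prod_unfold)
    also have "\<dots> = (\<Sum>(k, \<beta>)\<in>{..<q} \<times> (V \<rightarrow>\<^sub>E {..<q}). c (\<beta>(v := k)) * (\<Prod>w\<in>V. x w ^ \<beta> w) * x v ^ k)"
    proof (rule sum.cong[OF refl], clarify)
      fix k \<beta>
      have "(\<Prod>w\<in>V. x w ^ (\<beta>(v := k)) w) = (\<Prod>w\<in>V. x w ^ \<beta> w)"
        using insert.hyps(2) by (intro prod.cong) auto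
      then show "c (\<beta>(v := k)) * (\<Prod>w\<in>insert v V. x w ^ (\<beta>(v := k)) w) = c (\<beta>(v := k)) * (\<Prod>w\<in>V. x w ^ \<beta> w) * x v ^ k"
        using insert.hyps by (simp add: mult_ac)
    qed
    also have "\<dots> = (\<Sum>k<q. inner x k * x v ^ k)"
      by (simp add: inner_def sum_distrib_right sum.cartesian_product)
    finally show ?thesis .
  qed
  have \<beta>: "restrict \<alpha> V \<in> V \<rightarrow>\<^sub>E {..<q}" "\<alpha> v < q" using insert.prems(1) by (auto simp: PiE_iff)
  have "(restrict \<alpha> V)(v := \<alpha> v) = \<alpha>"
    using insert.prems(1) by (auto simp: fun_eq_iff PiE_iff extensional_def)
  then have "c ((restrict \<alpha> V)(v := \<alpha> v)) \<noteq> 0" using insert.prems(2) by simp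
  then obtain x where x: "inner x (\<alpha> v) \<noteq> 0"
    using insert.IH[OF \<beta>(1), of "\<lambda>\<beta>. c (\<beta>(v := \<alpha> v))"] unfolding inner_def by blast
  define p where "p = (\<Sum>k<q. monom (inner x k) k)"
  have "coeff p (\<alpha> v) = inner x (\<alpha> v)" using \<beta>(2) by (simp add: p_def coeff_sum)
  then have "p \<noteq> 0" using x by auto
  then obtain t where "poly p t \<noteq> 0" using poly_zero_cofinite[OF inf] by blast
  moreover have "poly p t = (\<Sum>k<q. inner (x(v := t)) k * (x(v := t)) v ^ k)"
  proof -
    have "inner (x(v := t)) k = inner x k" for k
      unfolding inner_def using insert.hyps(2) by (intro sum.cong arg_cong2[of _ _ _ _ "(*)"] prod.cong refl) auto
    then show ?thesis by (simp add: p_def poly_sum poly_monom)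
  qed
  ultimately have "(\<Sum>k<q. inner (x(v := t)) k * (x(v := t)) v ^ k) \<noteq> 0" by simp
  then show ?case unfolding sum by (rule exI[of _ "x(v := t)"])
qed


section \<open>Orbits in products of large dimension\<close>

text \<open>
  A multihomogeneous polynomial that vanishes on the frames \<open>A B\<^sub>i\<close> vanishes on all frames of the
  orbit of the point spanned by \<open>B\<close>, since frames of one subspace differ by a base change.
\<close>

lemma not_dense_if_vanishing_on_orbits:
  assumes "\<And>B :: nat \<Rightarrow> 'a::field mat. (\<And>i. i < length ds \<Longrightarrow> B i \<in> carrier_mat n (ds ! i)) \<Longrightarrow>
    \<exists>F. multihomogeneous n ds F \<and> nonvanishing n ds F \<noteq> {} \<and>
      (\<forall>A\<in>carrier_mat n n. poly_eval (plucker (\<lambda>i. A * B i)) F = 0)"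
  shows "\<not> dense_dim_vector TYPE('a) n ds"
proof
  assume "dense_dim_vector TYPE('a) n ds"
  then obtain W :: "nat \<Rightarrow> 'a vec set" where W: "W \<in> Gr_prod n ds"
    and dense: "zariski n ds closure_of (orbit (PGL TYPE('a) n) (diag_act ds) W) = topspace (zariski n ds)"
    unfolding dense_dim_vector_def topspace_zariski by blast
  obtain B where B: "\<And>i. i < length ds \<Longrightarrow> B i \<in> carrier_mat n (ds ! i)" and WB: "W = spanned n ds B"
    using obtain_frames[OF W] by blast
  obtain F where F: "multihomogeneous n ds F" "nonvanishing n ds F \<noteq> {}"
    and van: "\<And>A. A \<in> carrier_mat n n \<Longrightarrow> poly_eval (plucker (\<lambda>i. A * B i)) F = 0"
    using assms[of B] B by blast
  have "openin (zariski n ds) (nonvanishing n ds F)"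
    unfolding zariski_def using F(1) by (intro topology_generated_by_Basis) blast
  then obtain V where V: "V \<in> orbit (PGL TYPE('a) n) (diag_act ds) W" "V \<in> nonvanishing n ds F"
    using dense F(2) unfolding dense_intersects_open by blast
  have "V \<in> {spanned n ds (\<lambda>i. A * B i) | A. A \<in> carrier_mat n n \<and> det A \<noteq> 0}"
    using V(1) orbit_spanned[OF B] by (simp add: WB)
  then obtain A where A: "A \<in> carrier_mat n n" "V = spanned n ds (\<lambda>i. A * B i)"
    by (elim CollectE exE conjE)
  obtain B' where B': "\<And>i. i < length ds \<Longrightarrow> B' i \<in> frames (ds ! i) n (V i)" and nz: "poly_eval (plucker B') F \<noteq> 0"
    using V(2) unfolding nonvanishing_def by blast
  have AB: "A * B i \<in> carrier_mat n (ds ! i)" if "i < length ds" for i using A(1) B[OF that] by simp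
  have "\<exists>H. H \<in> carrier_mat (ds ! i) (ds ! i) \<and> B' i = A * B i * H" if i: "i < length ds" for i
  proof -
    have "B' i \<in> carrier_mat n (ds ! i)" "vec_space.col_space n (B' i) = vec_space.col_space n (A * B i)"
      using B'[OF i] i unfolding frames_def A(2) spanned_def by auto
    then show ?thesis using frame_change[OF AB[OF i], of "B' i" "ds ! i"] by blast
  qed
  then obtain H where H: "\<And>i. i < length ds \<Longrightarrow> H i \<in> carrier_mat (ds ! i) (ds ! i)"
    "\<And>i. i < length ds \<Longrightarrow> B' i = A * B i * H i" by metis
  obtain c where "poly_eval (plucker B') F = c * poly_eval (plucker (\<lambda>i. A * B i)) F"
    using poly_eval_frame_change[OF F(1), of "\<lambda>i. A * B i" H B', OF AB H] by blast
  then show False using van[OF A(1)] nz by simp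
qed

lemma det_2x2:
  fixes A :: "'a::comm_ring_1 mat"
  assumes A: "A \<in> carrier_mat 2 2"
  shows "det A = A $$ (0, 0) * A $$ (1, 1) - A $$ (0, 1) * A $$ (1, 0)"
proof -
  have "det A = (\<Sum>j<2. A $$ (0, j) * cofactor A 0 j)" by (rule laplace_expansion_row[OF A]) simp
  also have "\<dots> = A $$ (0, 0) * cofactor A 0 0 + A $$ (0, 1) * cofactor A 0 1"
    by (simp add: numeral_2_eq_2)
  also have "cofactor A 0 0 = A $$ (1, 1)"
    using A by (subst cofactor_def, subst det_single) (auto simp: mat_delete_def)
  also have "cofactor A 0 1 = - A $$ (1, 0)"
    using A by (subst cofactor_def, subst det_single) (auto simp: mat_delete_def)
  finally show ?thesis by simp
qed

lemma minor_single:
  fixes B :: "'a::comm_ring_1 mat"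
  assumes B: "B \<in> carrier_mat n 1" and r: "r < n"
  shows "det (submatrix B {r} UNIV) = B $$ (r, 0)"
proof -
  have I: "{r} \<subseteq> {..<n}" using r by simp
  have "{a \<in> {r}. a < r} = {}" by auto
  from pick_card_in_set[of r "{r}", unfolded this] have "pick {r} 0 = r" by (simp del: pick.simps)
  then show ?thesis using submatrix_carrier[OF B I] submatrix_rows_index(1)[OF B I, of 0 0]
    by (subst det_single) (simp_all del: pick.simps)
qed

lemma minor_pair:
  fixes B :: "'a::comm_ring_1 mat"
  assumes B: "B \<in> carrier_mat n 2" and jr: "j < r" "r < n"
  shows "det (submatrix B {j, r} UNIV) = B $$ (j, 0) * B $$ (r, 1) - B $$ (j, 1) * B $$ (r, 0)"
proof -
  have I: "{j, r} \<subseteq> {..<n}" using jr by simp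
  have card: "card {j, r} = 2" using jr by simp
  have below: "{a \<in> {j, r}. a < j} = {}" "{a \<in> {j, r}. a < r} = {j}" using jr by auto
  from pick_card_in_set[of j "{j, r}", unfolded below] have "pick {j, r} 0 = j"
    by (simp del: pick.simps)
  moreover from pick_card_in_set[of r "{j, r}", unfolded below] have "pick {j, r} 1 = r"
    by (simp del: pick.simps)
  ultimately show ?thesis
    using submatrix_carrier[OF B I] submatrix_rows_index(1)[OF B I] unfolding card
    by (subst det_2x2) (simp_all del: pick.simps)
qed

text \<open>
  The frames of the standard affine chart of the Grassmannians, with an identity block on top. The
  sign makes each coordinate equal to a Pluecker coordinate, instead of equal up to sign.
\<close>

definition chart :: "nat \<Rightarrow> nat list \<Rightarrow> (nat \<times> nat \<times> nat \<Rightarrow> 'a::field) \<Rightarrow> nat \<Rightarrow> 'a mat" where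
  "chart n ds x i = mat n (ds ! i) (\<lambda>(r, c). if r < ds ! i then (if r = c then 1 else 0)
     else if ds ! i = 2 \<and> c = 0 then - x (i, r, c) else x (i, r, c))"

lemma chart_carrier [simp]: "chart n ds x i \<in> carrier_mat n (ds ! i)"
  by (simp add: chart_def)

lemma injective_mat_if_unit_rows:
  fixes B :: "'a::field mat"
  assumes B: "B \<in> carrier_mat n d"
    and unit: "\<And>c. c < d \<Longrightarrow> \<exists>r<n. \<forall>k<d. B $$ (r, k) = (if k = c then 1 else 0)"
  shows "injective_mat B"
  unfolding injective_mat_def
proof (intro ballI impI eq_vecI)
  fix v j assume v: "v \<in> carrier_vec (dim_col B)" and 0: "B *\<^sub>v v = 0\<^sub>v (dim_row B)"
    and "j < dim_vec (0\<^sub>v (dim_col B) :: 'a vec)"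
  then have j: "j < d" using B by simp
  obtain r where r: "r < n" "\<forall>k<d. B $$ (r, k) = (if k = j then 1 else 0)" using unit[OF j] by blast
  have "row B r = unit_vec d j" using r B by (intro eq_vecI) (auto simp: unit_vec_def)
  then have "(B *\<^sub>v v) $ r = v $ j" using j r(1) v B by simp
  then show "v $ j = 0\<^sub>v (dim_col B) $ j" using 0 j r(1) B by simp
qed auto

lemma chart_injective:
  assumes "ds ! i \<le> n"
  shows "injective_mat (chart n ds x i)"
proof (rule injective_mat_if_unit_rows[OF chart_carrier])
  fix c assume "c < ds ! i"
  then show "\<exists>r<n. \<forall>k<ds ! i. chart n ds x i $$ (r, k) = (if k = c then 1 else 0)"
    using assms by (intro exI[of _ c]) (auto simp: chart_def)
qed

lemma chart_minors:
  assumes "ds ! i = 1 \<or> ds ! i = 2" "ds ! i \<le> n"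
  shows "plucker (chart n ds x) (i, {..<ds ! i}) = 1"
    and "c < ds ! i \<Longrightarrow> ds ! i \<le> r \<Longrightarrow> r < n \<Longrightarrow>
      plucker (chart n ds x) (i, insert r ({..<ds ! i} - {c})) = x (i, r, c)"
proof -
  consider (1) "ds ! i = 1" | (2) "ds ! i = 2" using assms(1) by blast
  then show "plucker (chart n ds x) (i, {..<ds ! i}) = 1"
  proof cases
    case 1
    then have "{..<ds ! i} = {0}" by auto
    then show ?thesis using minor_single[of "chart n ds x i" n 0] 1 assms(2) chart_carrier[of n ds x i]
      by (simp add: plucker_def chart_def)
  next
    case 2
    then have "{..<ds ! i} = {0, 1}" by auto
    then show ?thesis using minor_pair[of "chart n ds x i" n 0 1] 2 assms(2) chart_carrier[of n ds x i]
      by (simp add: plucker_def chart_def)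
  qed
  assume c: "c < ds ! i" and r: "ds ! i \<le> r" "r < n"
  consider (1) "ds ! i = 1" "c = 0" | (2) "ds ! i = 2" "c = 0" | (3) "ds ! i = 2" "c = 1"
    using assms(1) c by (auto simp: less_2_cases_iff)
  then show "plucker (chart n ds x) (i, insert r ({..<ds ! i} - {c})) = x (i, r, c)"
  proof cases
    case 1
    then have I: "insert r ({..<ds ! i} - {c}) = {r}" by auto
    show ?thesis unfolding I using minor_single[of "chart n ds x i" n r] 1 r chart_carrier[of n ds x i]
      by (simp add: plucker_def chart_def)
  next
    case 2
    then have I: "insert r ({..<ds ! i} - {c}) = {1, r}" by auto
    show ?thesis unfolding I using minor_pair[of "chart n ds x i" n 1 r] 2 r chart_carrier[of n ds x i]
      by (simp add: plucker_def chart_def)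
  next
    case 3
    then have I: "insert r ({..<ds ! i} - {c}) = {0, r}" by auto
    show ?thesis unfolding I using minor_pair[of "chart n ds x i" n 0 r] 3 r chart_carrier[of n ds x i]
      by (simp add: plucker_def chart_def)
  qed
qed

text \<open>
  If the product has dimension \<open>D \<ge> n\<^sup>2\<close>, every orbit satisfies a nontrivial equation. Take the
  \<open>q ^ D\<close> monomials in the chart coordinates with all exponents below \<open>q\<close>, made multihomogeneous with
  the Pluecker coordinates that are 1 on the chart. Evaluated on the frames \<open>A B\<^sub>i\<close> they become
  homogeneous polynomials of a common degree \<open>T\<close> in the entries of \<open>A\<close>, where \<open>T\<close> is linear in \<open>q\<close>. The
  space of these has dimension at most \<open>(T + 1) ^ (n\<^sup>2 - 1)\<close>, which is smaller than \<open>q ^ D\<close> for large \<open>q\<close>.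
  Hence some combination of the monomials vanishes on the orbit, while on the chart it is a nonzero
  polynomial.
\<close>

lemma not_dense_if_dimension_large:
  assumes inf: "infinite (UNIV :: 'a::field set)"
    and ds: "\<And>i. i < length ds \<Longrightarrow> (ds ! i = 1 \<or> ds ! i = 2) \<and> ds ! i \<le> n"
    and n: "1 \<le> n" and dim: "n ^ 2 \<le> (\<Sum>i<length ds. ds ! i * (n - ds ! i))"
  shows "\<not> dense_dim_vector TYPE('a) n ds"
proof (rule not_dense_if_vanishing_on_orbits)
  fix B :: "nat \<Rightarrow> 'a mat" assume B: "\<And>i. i < length ds \<Longrightarrow> B i \<in> carrier_mat n (ds ! i)"
  define coords where "coords = (SIGMA i:{..<length ds}. {ds ! i..<n} \<times> {..<ds ! i})"
  define D where "D = card coords"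
  have fin: "finite coords" by (auto simp: coords_def)
  have D: "n ^ 2 \<le> D" using dim by (simp add: D_def coords_def card_SigmaI mult.commute)
  define s where "s = (\<Sum>i<length ds. ds ! i)"
  \<comment> \<open>Large enough for \<open>(T + 1) ^ (n\<^sup>2 - 1) < q ^ D\<close>, since \<open>T + 1 \<le> (D * s + 1) * q\<close>.\<close>
  define q where "q = (D * s + 1) ^ (n ^ 2 - 1) + 1"
  \<comment> \<open>The common degree in each factor: no smaller than the degree of any of the monomials.\<close>
  define e where "e = D * q"
  define T where "T = (\<Sum>i<length ds. ds ! i * e)"
  define rows where "rows = (\<lambda>(i, r, c). insert r ({..<ds ! i} - {c}))"
  define rest where "rest = (\<lambda>\<alpha> i. e - (\<Sum>v\<in>coords. if fst v = i then \<alpha> v else 0))"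
  define mono where "mono = (\<lambda>\<alpha>. (\<Sum>v\<in>coords. Poly_Mapping.single (fst v, rows v) (\<alpha> v)) +
    (\<Sum>i<length ds. Poly_Mapping.single (i, {..<ds ! i}) (rest \<alpha> i)))"
  define A where "A = (coords \<rightarrow>\<^sub>E {..<q})"
  define V where "V = {..<n} \<times> {..<n}"
  have finA: "finite A" unfolding A_def using fin by (intro finite_PiE) auto
  have keys: "Poly_Mapping.keys (mono \<alpha>) \<subseteq> plucker_vars n ds" for \<alpha>
  proof -
    have 1: "(fst v, rows v) \<in> plucker_vars n ds" if "v \<in> coords" for v
    proof -
      obtain i r c where v: "v = (i, r, c)" "i < length ds" "ds ! i \<le> r" "r < n" "c < ds ! i"
        using \<open>v \<in> coords\<close> by (cases v) (auto simp: coords_def)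
      have "card (insert r ({..<ds ! i} - {c})) = ds ! i" using v by (simp add: card_insert_if)
      then show ?thesis using v by (auto simp: plucker_vars_def rows_def)
    qed
    have 2: "(i, {..<ds ! i}) \<in> plucker_vars n ds" if "i < length ds" for i
      using ds[OF that] that by (auto simp: plucker_vars_def)
    have "Poly_Mapping.keys (mono \<alpha>) \<subseteq>
        (\<Union>v\<in>coords. Poly_Mapping.keys (Poly_Mapping.single (fst v, rows v) (\<alpha> v))) \<union>
        (\<Union>i<length ds. Poly_Mapping.keys (Poly_Mapping.single (i, {..<ds ! i}) (rest \<alpha> i)))"
      unfolding mono_def by (rule order_trans[OF Poly_Mapping.keys_add]) (intro Un_mono keys_sum_subset)
    also have "\<dots> \<subseteq> plucker_vars n ds"
      using 1 2 by (intro Un_least UN_least) (simp_all split: if_splits)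
    finally show ?thesis .
  qed
  have deg: "degree_in i (mono \<alpha>) = e" if \<alpha>: "\<alpha> \<in> A" and i: "i < length ds" for \<alpha> i
  proof -
    let ?s = "\<Sum>v\<in>coords. if fst v = i then \<alpha> v else 0"
    have "\<alpha> v \<le> q" if "v \<in> coords" for v using \<alpha> that unfolding A_def by (auto dest!: PiE_mem)
    then have "?s \<le> (\<Sum>v\<in>coords. q)" by (intro sum_mono) auto
    then have "?s \<le> e" by (simp add: e_def D_def)
    then show ?thesis using i by (simp add: mono_def degree_in_add degree_in_sum rest_def)
  qed
  define M where "M = (\<lambda>g i. mat n n (\<lambda>(r, k). g (r, k)) * B i)"
  have Mc: "M g i \<in> carrier_mat n (ds ! i)" if "i < length ds" for g i
    using B[OF that] by (auto simp: M_def)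
  have lin: "hompoly V 1 (\<lambda>g. M g i $$ (r, c))" if i: "i < length ds" and rc: "r < n" "c < ds ! i" for i r c
  proof -
    have "hompoly V 1 (\<lambda>g. \<Sum>k<n. B i $$ (k, c) * g (r, k))"
      using rc by (intro hompoly_sum hompoly_smult hompoly.var) (auto simp: V_def)
    moreover have "M g i $$ (r, c) = (\<Sum>k<n. B i $$ (k, c) * g (r, k))" for g
      using B[OF i] rc by (auto simp: M_def scalar_prod_def lessThan_atLeast0 mult.commute intro!: sum.cong)
    ultimately show ?thesis by simp
  qed
  have hom: "hompoly V T (\<lambda>g. monomial_eval (plucker (M g)) (mono \<alpha>))" if "\<alpha> \<in> A" for \<alpha>
    using hompoly_plucker_monomial[where M = M and V = V, OF Mc lin keys, of \<alpha>] deg[OF that]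
    by (simp add: T_def)
  have finV: "finite V" by (simp add: V_def)
  have "\<forall>\<alpha>\<in>A. \<exists>c. \<forall>g. monomial_eval (plucker (M g)) (mono \<alpha>) =
      (\<Sum>\<beta>\<in>exponents V T. c \<beta> * (\<Prod>v\<in>V. g v ^ \<beta> v))"
    using hompoly_expand[OF finV hom] by blast
  from bchoice[OF this] obtain N where N: "\<forall>\<alpha>\<in>A. \<forall>g. monomial_eval (plucker (M g)) (mono \<alpha>) =
      (\<Sum>\<beta>\<in>exponents V T. N \<alpha> \<beta> * (\<Prod>v\<in>V. g v ^ \<beta> v))" ..
  have "card (exponents V T) < card A"
  proof -
    have "(0, 0) \<in> V" using n by (simp add: V_def)
    then have "V \<noteq> {}" by blast
    then have cV: "card V = n ^ 2" "V \<noteq> {}" by (simp_all add: V_def power2_eq_square)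
    have q: "1 \<le> q" by (simp add: q_def)
    have "T = s * (D * q)" by (simp add: T_def s_def e_def sum_distrib_right)
    then have "T + 1 \<le> (D * s + 1) * q" using q by (simp add: algebra_simps)
    then have "(T + 1) ^ (n ^ 2 - 1) \<le> ((D * s + 1) * q) ^ (n ^ 2 - 1)" by (rule power_mono) simp
    also have "\<dots> = (D * s + 1) ^ (n ^ 2 - 1) * q ^ (n ^ 2 - 1)" by (rule power_mult_distrib)
    also have "\<dots> < q * q ^ (n ^ 2 - 1)"
      using q by (intro mult_strict_right_mono) (auto simp: q_def)
    also have "\<dots> = q ^ (n ^ 2)" using n by (simp add: power_Suc[symmetric] del: power_Suc)
    also have "\<dots> \<le> q ^ D" using q D by (intro power_increasing)
    also have "\<dots> = card A" using fin by (simp add: A_def D_def card_PiE)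
    finally show ?thesis using card_exponents[OF finV cV(2), of T] by (simp add: cV)
  qed
  then obtain c where c: "\<exists>\<alpha>\<in>A. c \<alpha> \<noteq> 0" and ker: "\<forall>\<beta>\<in>exponents V T. (\<Sum>\<alpha>\<in>A. c \<alpha> * N \<alpha> \<beta>) = 0"
    using underdetermined_system_has_solution[OF finite_exponents[OF finV] finA, of T N] by blast
  obtain F where F: "multihomogeneous n ds F"
    "\<And>x. poly_eval x F = (\<Sum>\<alpha>\<in>A. c \<alpha> * monomial_eval x (mono \<alpha>))"
    using multihomogeneous_of_monomials[of A mono n ds "\<lambda>_. e" c] keys deg by blast
  have "poly_eval (plucker (\<lambda>i. G * B i)) F = 0" if G: "G \<in> carrier_mat n n" for G
  proof -
    define g where "g = (\<lambda>(r, k). G $$ (r, k))"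
    have "mat n n (\<lambda>(r, k). g (r, k)) = G" using G by (intro eq_matI) (auto simp: g_def)
    then have "(\<lambda>i. G * B i) = M g" by (simp add: M_def)
    then have "poly_eval (plucker (\<lambda>i. G * B i)) F
        = (\<Sum>\<alpha>\<in>A. c \<alpha> * (\<Sum>\<beta>\<in>exponents V T. N \<alpha> \<beta> * (\<Prod>v\<in>V. g v ^ \<beta> v)))"
      by (simp add: F(2)) (intro sum.cong refl arg_cong2[of _ _ _ _ "(*)"] N[rule_format])
    also have "\<dots> = (\<Sum>\<beta>\<in>exponents V T. (\<Sum>\<alpha>\<in>A. c \<alpha> * N \<alpha> \<beta>) * (\<Prod>v\<in>V. g v ^ \<beta> v))"
      unfolding sum_distrib_left sum_distrib_right by (subst sum.swap) (simp add: mult_ac)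
    finally show ?thesis using ker by simp
  qed
  moreover have "nonvanishing n ds F \<noteq> {}"
  proof -
    obtain x where x: "(\<Sum>\<alpha>\<in>A. c \<alpha> * (\<Prod>v\<in>coords. x v ^ \<alpha> v)) \<noteq> 0"
      using c nonzero_coefficients_nonzero_value[OF inf fin] unfolding A_def by blast
    have "monomial_eval (plucker (chart n ds x)) (mono \<alpha>) = (\<Prod>v\<in>coords. x v ^ \<alpha> v)" for \<alpha>
    proof -
      have "plucker (chart n ds x) (fst v, rows v) = x v" if "v \<in> coords" for v
        using that chart_minors(2)[of ds "fst v" n "snd (snd v)" "fst (snd v)" x] ds[of "fst v"]
        by (cases v) (auto simp: coords_def rows_def)
      moreover have "plucker (chart n ds x) (i, {..<ds ! i}) = 1" if "i < length ds" for i
        using chart_minors(1)[of ds i n x] ds[OF that] by blast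
      ultimately show ?thesis by (simp add: mono_def monomial_eval_add monomial_eval_sum)
    qed
    then have "poly_eval (plucker (chart n ds x)) F \<noteq> 0" using x F(2) by simp
    moreover have "spanned n ds (chart n ds x) \<in> Gr_prod n ds"
      using ds by (intro spanned_in_Gr_prod chart_injective) auto
    ultimately have "spanned n ds (chart n ds x) \<in> nonvanishing n ds F"
      unfolding nonvanishing_def
      by (intro CollectI conjI exI[of _ "chart n ds x"]) (auto simp: frames_def spanned_def)
    then show ?thesis by blast
  qed
  ultimately show "\<exists>F. multihomogeneous n ds F \<and> nonvanishing n ds F \<noteq> {} \<and>
      (\<forall>A\<in>carrier_mat n n. poly_eval (plucker (\<lambda>i. A * B i)) F = 0)"
    using F(1) by blast
qed


section \<open>Two points and two lines in the projective plane\<close>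

text \<open>
  The determinant of the vector spanning the \<open>i\<close>-th subspace, a point, and the two vectors spanning
  the \<open>j\<close>-th, a plane, expanded along the point.
\<close>

definition bracket :: "(nat \<times> nat set \<Rightarrow> 'a::comm_ring_1) \<Rightarrow> nat \<Rightarrow> nat \<Rightarrow> 'a" where
  "bracket x i j = (\<Sum>r<3. (- 1) ^ r * (x (i, {r}) * x (j, {..<3} - {r})))"

lemma bracket_plucker:
  fixes B :: "nat \<Rightarrow> 'a::field mat"
  assumes B: "B i \<in> carrier_mat 3 1" "B j \<in> carrier_mat 3 2"
  shows "bracket (plucker B) i j =
    B i $$ (0, 0) * (B j $$ (1, 0) * B j $$ (2, 1) - B j $$ (1, 1) * B j $$ (2, 0))
    - B i $$ (1, 0) * (B j $$ (0, 0) * B j $$ (2, 1) - B j $$ (0, 1) * B j $$ (2, 0))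
    + B i $$ (2, 0) * (B j $$ (0, 0) * B j $$ (1, 1) - B j $$ (0, 1) * B j $$ (1, 0))"
proof -
  have co: "{..<3} - {0} = {1, 2::nat}" "{..<3} - {1} = {0, 2::nat}" "{..<3} - {2} = {0, 1::nat}" by auto
  show ?thesis
    unfolding bracket_def sum_less_small co plucker_def prod.case
    using minor_single[OF B(1)] minor_pair[OF B(2)] by simp
qed

text \<open>
  Multiplicativity of the determinant for 3 by 3 matrices, expanded along the first column.
\<close>

lemma triple_product_mult:
  fixes a b c d e f g h i p q r u v w x y z :: "'a::comm_ring_1"
  shows "(a * p + b * q + c * r) * ((d * u + e * v + f * w) * (g * x + h * y + i * z) - (d * x + e * y + f * z) * (g * u + h * v + i * w))
    - (d * p + e * q + f * r) * ((a * u + b * v + c * w) * (g * x + h * y + i * z) - (a * x + b * y + c * z) * (g * u + h * v + i * w))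
    + (g * p + h * q + i * r) * ((a * u + b * v + c * w) * (d * x + e * y + f * z) - (a * x + b * y + c * z) * (d * u + e * v + f * w))
    = (a * (e * i - f * h) - b * (d * i - f * g) + c * (d * h - e * g))
      * (p * (v * z - y * w) - q * (u * z - x * w) + r * (u * y - x * v))"
proof -
  have minor: "(d * u + e * v + f * w) * (g * x + h * y + i * z) - (d * x + e * y + f * z) * (g * u + h * v + i * w)
    = (e * i - f * h) * (v * z - y * w) + (d * i - f * g) * (u * z - x * w) + (d * h - e * g) * (u * y - x * v)"
    for d e f g h i :: 'a by (simp add: algebra_simps)
  show ?thesis unfolding minor by (simp add: algebra_simps)
qed

lemma bracket_mult:
  fixes B :: "nat \<Rightarrow> 'a::field mat"
  assumes A: "A \<in> carrier_mat 3 3" and B: "B i \<in> carrier_mat 3 1" "B j \<in> carrier_mat 3 2"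
  shows "bracket (plucker (\<lambda>i. A * B i)) i j =
    (A $$ (0, 0) * (A $$ (1, 1) * A $$ (2, 2) - A $$ (1, 2) * A $$ (2, 1))
     - A $$ (0, 1) * (A $$ (1, 0) * A $$ (2, 2) - A $$ (1, 2) * A $$ (2, 0))
     + A $$ (0, 2) * (A $$ (1, 0) * A $$ (2, 1) - A $$ (1, 1) * A $$ (2, 0))) * bracket (plucker B) i j"
proof -
  have AB: "A * B i \<in> carrier_mat 3 1" "A * B j \<in> carrier_mat 3 2" using A B by simp_all
  have ent: "(A * M) $$ (r, c) = A $$ (r, 0) * M $$ (0, c) + A $$ (r, 1) * M $$ (1, c) + A $$ (r, 2) * M $$ (2, c)"
    if "M \<in> carrier_mat 3 d" "r < 3" "c < d" for M r c d
    using A that by (simp add: scalar_prod_def lessThan_atLeast0[symmetric] sum_less_small)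
  show ?thesis
    unfolding bracket_plucker[where B = B, OF B] bracket_plucker[where B = "\<lambda>i. A * B i", OF AB]
    by (simp only: ent[OF B(1)] ent[OF B(2)] zero_less_numeral one_less_numeral_iff numeral_less_iff
        less_numeral_simps semiring_norm zero_less_one triple_product_mult)
qed

text \<open>
  Here the dimension count leaves room for a dense orbit. However, in the projective plane the two
  lines cut out two further points on the line through the two given points, and the cross-ratio of
  the four is invariant. With the bracket \<open>[i j]\<close> of point \<open>i\<close> and plane \<open>j\<close> it is
  \<open>[0 2] [1 3] / [0 3] [1 2]\<close>. Hence every orbit lies in the zero locus of a nonzero combination of the
  numerator and the denominator.
\<close>

lemma not_dense_two_points_two_planes_in_3space:
  "\<not> dense_dim_vector TYPE('a::field) 3 (replicate 2 1 @ replicate 2 2)"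
proof (rule not_dense_if_vanishing_on_orbits)
  let ?ds = "replicate 2 1 @ replicate 2 2 :: nat list"
  fix B :: "nat \<Rightarrow> 'a mat" assume B: "\<And>i. i < length ?ds \<Longrightarrow> B i \<in> carrier_mat 3 (?ds ! i)"
  have ds: "?ds = [1, 1, 2, 2]" by (simp add: numeral_2_eq_2)
  define comb where "comb = (\<lambda>\<alpha> \<beta> x. \<alpha> * (bracket x 0 2 * bracket x 1 3) + \<beta> * (bracket x 0 3 * bracket x 1 2) :: 'a)"
  have ex: "\<exists>\<alpha> \<beta>. (\<alpha> \<noteq> 0 \<or> \<beta> \<noteq> 0) \<and> comb \<alpha> \<beta> (plucker B) = 0"
  proof (cases "bracket (plucker B) 0 2 * bracket (plucker B) 1 3 = 0")
    case True
    then show ?thesis by (intro exI[of _ 1] exI[of _ 0]) (simp add: comb_def)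
  next
    case False
    then show ?thesis
      by (intro exI[of _ "bracket (plucker B) 0 3 * bracket (plucker B) 1 2"]
          exI[of _ "- (bracket (plucker B) 0 2 * bracket (plucker B) 1 3)"]) (simp add: comb_def)
  qed
  then obtain \<alpha> \<beta> where ab: "\<alpha> \<noteq> 0 \<or> \<beta> \<noteq> 0" "comb \<alpha> \<beta> (plucker B) = 0" by blast
  \<comment> \<open>The Boolean selects one of the two products of brackets; \<open>r\<close> and \<open>t\<close> are the summation indices
    of its factors.\<close>
  define S where "S = (UNIV :: bool set) \<times> {..<3::nat} \<times> {..<3::nat}"
  define coef where "coef = (\<lambda>(b, r, t). (if b then \<alpha> else \<beta>) * ((- 1) ^ r * (- 1) ^ t))"
  define mono where "mono = (\<lambda>(b, r::nat, t::nat). Poly_Mapping.single (0::nat, {r}) 1 + Poly_Mapping.single (1, {t}) 1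
    + Poly_Mapping.single (if b then 2 else 3, {..<3} - {r}) 1
    + Poly_Mapping.single (if b then 3 else 2, {..<3} - {t}) (1::nat))"
  have keys: "Poly_Mapping.keys (mono s) \<subseteq> plucker_vars 3 ?ds" if "s \<in> S" for s
  proof -
    obtain b r t where s: "s = (b, r, t)" "r < 3" "t < 3" using \<open>s \<in> S\<close> by (cases s) (auto simp: S_def)
    have co: "card ({..<3} - {r}) = 2" if "r < 3" for r :: nat using that by simp
    have "Poly_Mapping.keys (mono s) \<subseteq> {(0, {r}), (1, {t}), (if b then 2 else 3, {..<3} - {r}), (if b then 3 else 2, {..<3} - {t})}"
      unfolding s(1) mono_def prod.case
      by (intro order_trans[OF Poly_Mapping.keys_add] Un_least) auto
    also have "\<dots> \<subseteq> plucker_vars 3 ?ds"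
      using s(2,3) co[OF s(2)] co[OF s(3)] unfolding ds by (auto simp: plucker_vars_def)
    finally show ?thesis .
  qed
  have deg: "degree_in i (mono s) = 1" if "i < length ?ds" for i s
  proof -
    have "i = 0 \<or> i = 1 \<or> i = 2 \<or> i = 3" using that by auto
    then show ?thesis by (cases s) (auto simp: mono_def degree_in_add)
  qed
  obtain F where F: "multihomogeneous 3 ?ds F" "\<And>x. poly_eval x F = (\<Sum>s\<in>S. coef s * monomial_eval x (mono s))"
    using multihomogeneous_of_monomials[of S mono 3 ?ds "\<lambda>_. 1" coef] keys deg by blast
  have eval: "poly_eval x F = comb \<alpha> \<beta> x" for x
  proof -
    have "poly_eval x F = (\<Sum>b\<in>UNIV. \<Sum>r<3. \<Sum>t<3. coef (b, r, t) * monomial_eval x (mono (b, r, t)))"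
      unfolding F(2) S_def sum.cartesian_product by (simp add: case_prod_unfold)
    also have "\<dots> = comb \<alpha> \<beta> x"
      unfolding comb_def bracket_def sum_product
      by (simp add: UNIV_bool coef_def mono_def monomial_eval_add sum_distrib_left mult_ac add.commute)
    finally show ?thesis .
  qed
  have "poly_eval (plucker (\<lambda>i. A * B i)) F = 0" if A: "A \<in> carrier_mat 3 3" for A
  proof -
    have "B 0 \<in> carrier_mat 3 1" "B 1 \<in> carrier_mat 3 1" "B 2 \<in> carrier_mat 3 2" "B 3 \<in> carrier_mat 3 2"
      using B[of 0] B[of 1] B[of 2] B[of 3] unfolding ds by simp_all
    then obtain \<delta> where "\<And>i j. i = 0 \<or> i = 1 \<Longrightarrow> j = 2 \<or> j = 3 \<Longrightarrow>
        bracket (plucker (\<lambda>i. A * B i)) i j = \<delta> * bracket (plucker B) i j"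
      using bracket_mult[OF A] by blast
    then have "comb \<alpha> \<beta> (plucker (\<lambda>i. A * B i)) = \<delta> * \<delta> * comb \<alpha> \<beta> (plucker B)"
      by (simp add: comb_def algebra_simps)
    then show ?thesis by (simp add: eval ab(2))
  qed
  moreover have "nonvanishing 3 ?ds F \<noteq> {}"
  proof -
    \<comment> \<open>Point 0 lies in one of the two planes, chosen so that only a product with nonzero coefficient
      survives.\<close>
    define C where "C = (\<lambda>i. mat 3 ([1, 1, 2, 2] ! i) (\<lambda>(r, c).
      (if i = 0 then [[1], [0], [0]] else if i = 1 then [[0], [1], [0]]
       else if (i = 2) = (\<alpha> \<noteq> 0) then [[0, 0], [1, 0], [0, 1]] else [[1, 0], [0, 0], [0, 1::'a]]) ! r ! c))"
    have Cc: "C i \<in> carrier_mat 3 (?ds ! i)" for i unfolding ds by (simp add: C_def)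
    have C: "C 0 \<in> carrier_mat 3 1" "C 1 \<in> carrier_mat 3 1" "C 2 \<in> carrier_mat 3 2" "C 3 \<in> carrier_mat 3 2"
      using Cc[of 0] Cc[of 1] Cc[of 2] Cc[of 3] unfolding ds by simp_all
    have "injective_mat (C i)" if i: "i < length ?ds" for i
    proof (rule injective_mat_if_unit_rows[OF Cc])
      fix c assume c: "c < ?ds ! i"
      consider "i = 0" | "i = 1" | "i = 2 \<or> i = 3" using i by fastforce
      then show "\<exists>r<3. \<forall>k<?ds ! i. C i $$ (r, k) = (if k = c then 1 else 0)"
      proof cases
        case 1
        then show ?thesis using c unfolding ds by (intro exI[of _ 0]) (simp add: C_def)
      next
        case 2
        then show ?thesis using c unfolding ds by (intro exI[of _ 1]) (simp add: C_def)
      next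
        case 3
        then have "c = 0 \<or> c = 1" using c unfolding ds by (auto simp: less_2_cases_iff)
        with 3 show ?thesis unfolding ds
          by (intro exI[of _ "if (i = 2) = (\<alpha> \<noteq> 0) then [1, 2] ! c else [0, 2] ! c"])
            (auto simp: C_def less_2_cases_iff)
      qed
    qed
    then have "spanned 3 ?ds C \<in> Gr_prod 3 ?ds" using Cc by (intro spanned_in_Gr_prod)
    moreover have "comb \<alpha> \<beta> (plucker C) \<noteq> 0"
      using ab(1)
      unfolding comb_def bracket_plucker[where B = C, OF C(1) C(3)] bracket_plucker[where B = C, OF C(2) C(3)]
         bracket_plucker[where B = C, OF C(1) C(4)] bracket_plucker[where B = C, OF C(2) C(4)]
      by (simp add: C_def)
    ultimately have "spanned 3 ?ds C \<in> nonvanishing 3 ?ds F"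
      unfolding nonvanishing_def using Cc eval
      by (intro CollectI conjI exI[of _ C]) (auto simp: frames_def spanned_def)
    then show ?thesis by blast
  qed
  ultimately show "\<exists>F. multihomogeneous 3 ?ds F \<and> nonvanishing 3 ?ds F \<noteq> {} \<and>
      (\<forall>A\<in>carrier_mat 3 3. poly_eval (plucker (\<lambda>i. A * B i)) F = 0)"
    using F(1) by blast
qed


section \<open>The classification\<close>

lemma infinite_UNIV_alg_closed: "infinite (UNIV :: 'a::alg_closed_field set)"
proof
  assume fin: "finite (UNIV :: 'a set)"
  define p where "p = (\<Prod>a\<in>(UNIV :: 'a set). [:- a, 1:]) + 1"
  have val: "poly p x = 1" for x
  proof -
    have "poly (\<Prod>a\<in>(UNIV :: 'a set). [:- a, 1:]) x = 0"
      using fin by (simp add: poly_prod prod_zero_iff)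
    then show ?thesis by (simp add: p_def)
  qed
  have "degree (\<Prod>a\<in>(UNIV :: 'a set). [:- a, 1:]) = card (UNIV :: 'a set)"
    by (subst degree_prod_sum_eq) auto
  moreover have "card (UNIV :: 'a set) > 0" using fin by (simp add: card_gt_0_iff)
  ultimately have "degree p > 0" unfolding p_def by (subst degree_add_eq_left) auto
  then obtain x where "poly p x = 0" using alg_closed_imp_poly_has_root by blast
  then show False using val by simp
qed

lemma dimension_points_planes:
  "(\<Sum>i<length (replicate a 1 @ replicate b 2 :: nat list). (replicate a 1 @ replicate b 2) ! i *
     (n - (replicate a 1 @ replicate b 2) ! i)) = a * (n - 1) + b * (2 * (n - 2 :: nat))"
proof -
  have *: "(\<Sum>i<length ds. ds ! i * (n - ds ! i)) = (\<Sum>d\<leftarrow>ds. d * (n - d))" for ds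
    by (simp add: sum_list_sum_nth lessThan_atLeast0)
  show ?thesis unfolding *[of "replicate a 1 @ replicate b 2"] by (simp add: sum_list_replicate)
qed

text \<open>
  With \<open>n = m + 3\<close> and \<open>a + 2 b = n + 2 + k\<close> the dimension exceeds \<open>n\<^sup>2 - 4\<close> by \<open>k (m + 1) + a\<close>. This is
  less than 4 only for the excluded vectors and for \<open>k = 0\<close>, \<open>a \<le> 3\<close>.
\<close>

lemma remaining_cases_have_large_dimension:
  fixes a b n :: nat
  assumes n: "3 \<le> n" and big: "n + 2 \<le> a + 2 * b" and a: "a + 2 * b = n + 2 \<longrightarrow> 4 \<le> a"
    and exc: "(a, b, n) \<notin> {(0, 3, 3), (1, 3, 3), (0, 4, 3), (1, 3, 4), (0, 4, 5), (2, 2, 3)}"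
  shows "n ^ 2 \<le> a * (n - 1) + b * (2 * (n - 2))"
proof -
  obtain m where m: "n = m + 3" using n by (metis add.commute le_Suc_ex)
  obtain k where k: "a + 2 * b = n + 2 + k" using big by (metis le_Suc_ex)
  have dim: "a * (n - 1) + b * (2 * (n - 2)) = (m + 5 + k) * (m + 1) + a"
  proof -
    have "a * (n - 1) + b * (2 * (n - 2)) = (a + 2 * b) * (m + 1) + a" by (simp add: m algebra_simps)
    then show ?thesis by (simp add: k m)
  qed
  have "4 \<le> k * (m + 1) + a"
  proof (cases "k = 0 \<or> 4 \<le> a \<or> 4 \<le> k")
    case True
    then show ?thesis using a k by (auto simp: algebra_simps)
  next
    case False
    then have small: "k = 1 \<or> k = 2 \<or> k = 3" "a = 0 \<or> a = 1 \<or> a = 2 \<or> a = 3" by auto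
    show ?thesis
    proof (cases "3 \<le> m")
      case True
      have "1 * 4 \<le> k * (m + 1)" using small(1) True by (intro mult_le_mono) auto
      then show ?thesis by simp
    next
      case False
      then have "m = 0 \<or> m = 1 \<or> m = 2" by auto
      then show ?thesis using small exc k m by (elim disjE) (auto, presburger+)
    qed
  qed
  then show ?thesis unfolding dim by (simp add: m power2_eq_square algebra_simps)
qed

theorem mainTheorem3:
  fixes a b n :: nat
  assumes "b \<ge> 1" and "n \<ge> 3"
  shows "dense_dim_vector TYPE('a::alg_closed_field) n (replicate a 1 @ replicate b 2) \<longleftrightarrow>
    (a + 2 * b \<le> n + 1 \<or>
     (a + 2 * b = n + 2 \<and> a \<le> 3) \<or>
     (a, b, n) \<in> {(0, 3, 3), (1, 3, 3), (0, 4, 3), (1, 3, 4), (0, 4, 5)})"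
    (is "?dense a b n \<longleftrightarrow> ?cond")
proof
  note inf = infinite_UNIV_alg_closed[where 'a = 'a]
  show "?dense a b n" if cond: ?cond
  proof -
    consider "a + 2 * b \<le> n + 1" | "a + 2 * b = n + 2" "a \<le> 3"
      | "a = 0" "b \<le> 4" "n = 3" | "a = 1" "b = 3" "n = 3"
      | "a = 1" "b = 3" "n = 4" | "a = 0" "b = 4" "n = 5"
      using cond by auto
    then show ?thesis
    proof cases
      case 1 then show ?thesis using dense_at_most_one_relation[OF inf assms(1)] assms(2) by simp
    next
      case 2 then show ?thesis using dense_two_relations[OF inf assms(1)] assms(2) by simp
    next
      case 3 then show ?thesis using dense_planes_in_3space[OF inf, of b] by simp
    next
      case 4 then show ?thesis using dense_point_three_planes_in_3space[OF inf] by simp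
    next
      case 5 then show ?thesis using dense_point_three_planes_in_4space[OF inf] by simp
    next
      case 6 then show ?thesis using dense_four_planes_in_5space[OF inf] by simp
    qed
  qed
  show ?cond if "?dense a b n"
  proof (rule ccontr)
    assume "\<not> ?cond"
    then have no: "\<not> a + 2 * b \<le> n + 1" "\<not> (a + 2 * b = n + 2 \<and> a \<le> 3)"
      "(a, b, n) \<notin> {(0, 3, 3), (1, 3, 3), (0, 4, 3), (1, 3, 4), (0, 4, 5)}" by blast+
    have ne: "(a, b, n) \<noteq> (2, 2, 3)"
      using that not_dense_two_points_two_planes_in_3space[where 'a = 'a] by auto
    have "n ^ 2 \<le> a * (n - 1) + b * (2 * (n - 2))"
    proof (rule remaining_cases_have_large_dimension[OF assms(2)])
      show "n + 2 \<le> a + 2 * b" using no(1) by linarith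
      show "a + 2 * b = n + 2 \<longrightarrow> 4 \<le> a" using no(2) by linarith
      show "(a, b, n) \<notin> {(0, 3, 3), (1, 3, 3), (0, 4, 3), (1, 3, 4), (0, 4, 5), (2, 2, 3)}"
        using no(3) ne by blast
    qed
    moreover have "(replicate a 1 @ replicate b 2) ! i = (if i < a then 1 else 2 :: nat)"
      if "i < length (replicate a 1 @ replicate b 2 :: nat list)" for i
      using that by (auto simp: nth_append)
    ultimately have "\<not> ?dense a b n"
    proof (intro not_dense_if_dimension_large[OF inf])
      show "n ^ 2 \<le> (\<Sum>i<length (replicate a 1 @ replicate b 2 :: nat list). (replicate a 1 @ replicate b 2) ! i *
          (n - (replicate a 1 @ replicate b 2) ! i))" if "n ^ 2 \<le> a * (n - 1) + b * (2 * (n - 2))"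
        unfolding dimension_points_planes by (rule that)
    qed (use assms(2) in auto)
    then show False using that by simp
  qed
qed

end
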